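(* Let $n\ge 2$ and let $\mathbf A$ be a pure Boolean-like algebra of dimension $n$. Then $\mathbf A\cong\mathrm{Ce}(B_{\mathbf A}^n)\cong\mathbf n[B_{\mathbf A}]$, and $\mathbf n[B_{\mathbf A}]$ is a retract of $\mathbf A[B_{\mathbf A}]$.
   Context: A pure algebra of dimension $n$ is an algebra $(A,q,\mathsf e_1,\dots,\mathsf e_n)$ of type $\nu_n$ ($q$ of arity $n+1$, $\mathsf e_i$ constants) with $q(\mathsf e_i,b_1,\dots,b_n)=b_i$. For any algebra with such operations $q,\mathsf e_i$ (possibly among others), $\theta(a,b)$ is the smallest congruence containing $(a,b)$, and $c$ is $n$-central if $x\mapsto(x/\theta(c,\mathsf e_1),\dots,x/\theta(c,\mathsf e_n))$ is an isomorphism onto $\prod_i\mathbf A/\theta(c,\mathsf e_i)$; a pure Boolean-like algebra of dimension $n$ is a pure algebra of dimension $n$ all of whose elements are $n$-central. Let $p(x,y,z)=q(x,y,z,\mathsf e_3,\dots,\mathsf e_n)$ and $B_{\mathbf A}=\{x\in A:p(x,y,y)=y\ \forall y\in A\}$; this is a Boolean algebra with $x\wedge y=p(x,\mathsf e_1,y)$, $x\vee y=p(x,y,\mathsf e_2)$, $\neg x=p(x,\mathsf e_2,\mathsf e_1)$, $0=\mathsf e_1$, $1=\mathsf e_2$, and it is regarded as the semiring $(B_{\mathbf A},\vee,\wedge,0,1)$. $B_{\mathbf A}^n$ is the free $B_{\mathbf A}$-semimodule with basis $\mathsf e_1,\dots,\mathsf e_n$ (vectors $\sum_i v_i\mathsf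 e_i$, coordinatewise $\vee$ as addition, $r\mathbf v=\sum(r\wedge v_i)\mathsf e_i$), made into an algebra of dimension $n$ (together with its semimodule operations) by $q(\mathbf v,\mathbf w^1,\dots,\mathbf w^n)=\sum_i v_i\mathbf w^i$ and constants the basis vectors; $\mathrm{Ce}(B_{\mathbf A}^n)$ is the algebra $(\text{set of }n\text{-central elements},q,\mathsf e_1,\dots,\mathsf e_n)$. Semiring power: for a semiring $R$ and an algebra $\mathbf E$ of type $\tau$ with universe $E$, let $V$ be the free left $R$-semimodule on $E$ (finite-support formal sums $\sum_{\mathsf d\in E}v_{\mathsf d}\mathsf d$); lift each $k$-ary $g\in\tau$ by $g^V(\mathbf v^1,\dots,\mathbf v^k)=\sum_{\mathsf d_1,\dots,\mathsf d_k}(v^1_{\mathsf d_1}\cdots v^k_{\mathsf d_k})g^{\mathbf E}(\mathsf d_1,\dots,\mathsf d_k)$; for finite nonempty $I=\{\mathsf c_1,\dots,\mathsf c_m\}\subseteq E$ let $q_I(\mathbf v,\mathbf w^1,\dots,\mathbf w^m)=\sum_i v_{\mathsf c_i}\mathbf w^i$; $V_{\mathbf E}$ is $V$ with the semimodule operations, all $g^V$, all $q_I$, and all elements of $E$ as constants; $\mathbf v$ is finitely central if for some such $I$ it is $m$-central in $V_{\mathbf E}$ with respect to $q_I$ and $\mathsf c_1,\dots,\mathsf c_m$; the semiring power $\mathbf E[R]$ is the set of finitely central vectors with the restricted operations $g^V$, $g\in\tau$. Here $\mathbf n$ (universe $\{\mathsf e_1,\dots,\mathsf e_n\}$, $q^{\mathbf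 n}(\mathsf e_i,x_1,\dots,x_n)=x_i$) and $\mathbf A$ are of type $\nu_n$, so $\mathbf n[B_{\mathbf A}]$ and $\mathbf A[B_{\mathbf A}]$ are algebras of type $\nu_n$. $\mathbf C$ is a retract of $\mathbf D$ if there are homomorphisms $f:\mathbf C\to\mathbf D$ and $h:\mathbf D\to\mathbf C$ with $h\circ f=\mathrm{id}_C$. *)

theory Defs
  imports "HOL-Algebra.Ring"
begin

section \<open>Universal algebra\<close>

record 'f signature =
  symbols :: "'f set"
  arity :: "'f \<Rightarrow> nat"

text \<open>An operation is applied to the list of its arguments; only lists over the carrier of the
  length prescribed by the signature are meaningful.\<close>

record ('f, 'a) ualg = "'a partial_object" +
  interp :: "'f \<Rightarrow> 'a list \<Rightarrow> 'a"

definition args :: "'f signature \<Rightarrow> ('f, 'a) ualg \<Rightarrow> 'f \<Rightarrow> 'a list set" where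
  "args S A f = {xs. length xs = arity S f \<and> set xs \<subseteq> carrier A}"

definition ua_algebra :: "'f signature \<Rightarrow> ('f, 'a) ualg \<Rightarrow> bool" where
  "ua_algebra S A \<longleftrightarrow>
     carrier A \<noteq> {} \<and> (\<forall>f \<in> symbols S. \<forall>xs \<in> args S A f. interp A f xs \<in> carrier A)"

definition ua_hom :: "'f signature \<Rightarrow> ('f, 'a) ualg \<Rightarrow> ('f, 'b) ualg \<Rightarrow> ('a \<Rightarrow> 'b) set" where
  "ua_hom S A B =
     {h \<in> carrier A \<rightarrow> carrier B.
        \<forall>f \<in> symbols S. \<forall>xs \<in> args S A f. h (interp A f xs) = interp B f (map h xs)}"

definition ua_iso :: "'f signature \<Rightarrow> ('f, 'a) ualg \<Rightarrow> ('f, 'b) ualg \<Rightarrow> ('a \<Rightarrow> 'b) set" where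
  "ua_iso S A B = {h \<in> ua_hom S A B. bij_betw h (carrier A) (carrier B)}"

definition ua_isomorphic :: "'f signature \<Rightarrow> ('f, 'a) ualg \<Rightarrow> ('f, 'b) ualg \<Rightarrow> bool" where
  "ua_isomorphic S A B \<longleftrightarrow> ua_algebra S A \<and> ua_algebra S B \<and> ua_iso S A B \<noteq> {}"

definition ua_retract :: "'f signature \<Rightarrow> ('f, 'a) ualg \<Rightarrow> ('f, 'b) ualg \<Rightarrow> bool" where
  "ua_retract S C D \<longleftrightarrow> ua_algebra S C \<and> ua_algebra S D \<and>
     (\<exists>f \<in> ua_hom S C D. \<exists>h \<in> ua_hom S D C. \<forall>x \<in> carrier C. h (f x) = x)"

definition congruence :: "'f signature \<Rightarrow> ('f, 'a) ualg \<Rightarrow> ('a \<times> 'a) set \<Rightarrow> bool" where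
  "congruence S A r \<longleftrightarrow> equiv (carrier A) r \<and>
     (\<forall>f \<in> symbols S. \<forall>xs \<in> args S A f. \<forall>ys \<in> args S A f.
        list_all2 (\<lambda>x y. (x, y) \<in> r) xs ys \<longrightarrow> (interp A f xs, interp A f ys) \<in> r)"

definition theta :: "'f signature \<Rightarrow> ('f, 'a) ualg \<Rightarrow> 'a \<Rightarrow> 'a \<Rightarrow> ('a \<times> 'a) set" where
  "theta S A a b = \<Inter> {r. congruence S A r \<and> (a, b) \<in> r}"

text \<open>The union is over all choices of representatives; for a congruence all the classes that
  occur in it coincide.\<close>

definition ua_quot :: "('f, 'a) ualg \<Rightarrow> ('a \<times> 'a) set \<Rightarrow> ('f, 'a set) ualg" where
  "ua_quot A r =
     \<lparr>carrier = carrier A // r,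
      interp = (\<lambda>f Xs. \<Union>xs \<in> listset Xs. r `` {interp A f xs})\<rparr>"

definition ua_prod :: "'i set \<Rightarrow> ('i \<Rightarrow> ('f, 'a) ualg) \<Rightarrow> ('f, 'i \<Rightarrow> 'a) ualg" where
  "ua_prod I As =
     \<lparr>carrier = (\<Pi>\<^sub>E i \<in> I. carrier (As i)),
      interp = (\<lambda>f xs. \<lambda>i \<in> I. interp (As i) f (map (\<lambda>x. x i) xs))\<rparr>"


section \<open>Algebras with operations \<open>q, e\<^sub>1, \<dots>, e\<^sub>n\<close> and their central elements\<close>

text \<open>Here \<open>q\<close> and the entries of the list \<open>es\<close> are operation symbols of \<open>S\<close>; \<open>n\<close> is the length
  of \<open>es\<close>, and \<open>S\<close> may have further symbols.\<close>

definition has_dim :: "'f signature \<Rightarrow> ('f, 'a) ualg \<Rightarrow> 'f \<Rightarrow> 'f list \<Rightarrow> bool" where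
  "has_dim S A q es \<longleftrightarrow>
     q \<in> symbols S \<and> arity S q = Suc (length es) \<and>
     (\<forall>e \<in> set es. e \<in> symbols S \<and> arity S e = 0) \<and>
     (\<forall>i < length es. \<forall>bs. length bs = length es \<and> set bs \<subseteq> carrier A \<longrightarrow>
        interp A q (interp A (es ! i) [] # bs) = bs ! i)"

definition n_central :: "'f signature \<Rightarrow> ('f, 'a) ualg \<Rightarrow> 'f \<Rightarrow> 'f list \<Rightarrow> 'a \<Rightarrow> bool" where
  "n_central S A q es c \<longleftrightarrow> has_dim S A q es \<and> c \<in> carrier A \<and>
     (let \<theta> = (\<lambda>i. theta S A c (interp A (es ! i) []))
      in (\<lambda>x. \<lambda>i \<in> {..<length es}. \<theta> i `` {x})
           \<in> ua_iso S A (ua_prod {..<length es} (\<lambda>i. ua_quot A (\<theta> i))))"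

datatype nu_sym = Qop | Ec nat

definition nu :: "nat \<Rightarrow> nu_sym signature" where
  "nu n = \<lparr>symbols = insert Qop (Ec ` {1..n}),
           arity = (\<lambda>s. case s of Qop \<Rightarrow> n + 1 | Ec _ \<Rightarrow> 0)\<rparr>"

abbreviation nu_consts :: "nat \<Rightarrow> nu_sym list" where
  "nu_consts n \<equiv> map Ec [1..<Suc n]"

definition pure_algebra :: "nat \<Rightarrow> (nu_sym, 'a) ualg \<Rightarrow> bool" where
  "pure_algebra n A \<longleftrightarrow> ua_algebra (nu n) A \<and> has_dim (nu n) A Qop (nu_consts n)"

definition pure_boolean_like :: "nat \<Rightarrow> (nu_sym, 'a) ualg \<Rightarrow> bool" where
  "pure_boolean_like n A \<longleftrightarrow> pure_algebra n A \<and>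
     (\<forall>c \<in> carrier A. n_central (nu n) A Qop (nu_consts n) c)"

definition Ce :: "'f signature \<Rightarrow> ('f, 'a) ualg \<Rightarrow> 'f \<Rightarrow> 'f list \<Rightarrow> (nu_sym, 'a) ualg" where
  "Ce S A q es =
     \<lparr>carrier = {c. n_central S A q es c},
      interp = (\<lambda>s xs. case s of Qop \<Rightarrow> interp A q xs | Ec i \<Rightarrow> interp A (es ! (i - 1)) xs)\<rparr>"

text \<open>The constant \<open>e\<^sub>i\<close> is \<open>i\<close> itself. In the list of arguments of \<open>q\<close>, the element selecting the
  projection has position 0, so \<open>x\<^sub>i\<close> has position \<open>i\<close>.\<close>

definition n_alg :: "nat \<Rightarrow> (nu_sym, nat) ualg" where
  "n_alg n =
     \<lparr>carrier = {1..n},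
      interp = (\<lambda>s xs. case s of Qop \<Rightarrow> xs ! (hd xs) | Ec i \<Rightarrow> i)\<rparr>"


section \<open>The Boolean semiring of an algebra of dimension \<open>n\<close>\<close>

definition p_op :: "nat \<Rightarrow> (nu_sym, 'a) ualg \<Rightarrow> 'a \<Rightarrow> 'a \<Rightarrow> 'a \<Rightarrow> 'a" where
  "p_op n A x y z = interp A Qop ([x, y, z] @ map (\<lambda>i. interp A (Ec i) []) [3..<Suc n])"

definition B_semiring :: "nat \<Rightarrow> (nu_sym, 'a) ualg \<Rightarrow> 'a ring" where
  "B_semiring n A =
     \<lparr>carrier = {x \<in> carrier A. \<forall>y \<in> carrier A. p_op n A x y y = y},
      mult = (\<lambda>x y. p_op n A x (interp A (Ec 1) []) y),
      one = interp A (Ec 2) [],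
      zero = interp A (Ec 1) [],
      add = (\<lambda>x y. p_op n A x y (interp A (Ec 2) []))\<rparr>"


section \<open>Free semimodules\<close>

definition supp :: "'r ring \<Rightarrow> ('e \<Rightarrow> 'r) \<Rightarrow> 'e set" where
  "supp R v = {d. v d \<noteq> \<zero>\<^bsub>R\<^esub>}"

text \<open>The formal sum \<open>\<Sum>\<^sub>d v\<^sub>d d\<close> over \<open>d \<in> E\<close> is the function \<open>v\<close>, extended by zero outside \<open>E\<close>.\<close>

definition free_vecs :: "'r ring \<Rightarrow> 'e set \<Rightarrow> ('e \<Rightarrow> 'r) set" where
  "free_vecs R E = {v. range v \<subseteq> carrier R \<and> supp R v \<subseteq> E \<and> finite (supp R v)}"

definition unit_vec :: "'r ring \<Rightarrow> 'e \<Rightarrow> 'e \<Rightarrow> 'r" where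
  "unit_vec R d = (\<lambda>d'. if d' = d then \<one>\<^bsub>R\<^esub> else \<zero>\<^bsub>R\<^esub>)"

datatype 'r sm_sym = SAdd | SZero | SScal 'r

definition sm_symbols :: "'r ring \<Rightarrow> 'r sm_sym set" where
  "sm_symbols R = {SAdd, SZero} \<union> SScal ` carrier R"

fun sm_arity :: "'r sm_sym \<Rightarrow> nat" where
  "sm_arity SAdd = 2"
| "sm_arity SZero = 0"
| "sm_arity (SScal r) = 1"

definition sm_interp :: "'r ring \<Rightarrow> 'r sm_sym \<Rightarrow> ('e \<Rightarrow> 'r) list \<Rightarrow> 'e \<Rightarrow> 'r" where
  "sm_interp R s vs =
     (case s of
        SAdd \<Rightarrow> (\<lambda>d. (vs ! 0) d \<oplus>\<^bsub>R\<^esub> (vs ! 1) d)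
      | SZero \<Rightarrow> (\<lambda>d. \<zero>\<^bsub>R\<^esub>)
      | SScal r \<Rightarrow> (\<lambda>d. r \<otimes>\<^bsub>R\<^esub> (vs ! 0) d))"

text \<open>\<open>q\<^sub>I(v, w\<^sup>1, \<dots>, w\<^sup>m) = \<Sum>\<^sub>i v(c\<^sub>i) w\<^sup>i\<close> for \<open>I\<close> enumerated by the list \<open>cs\<close>; the argument list
  is \<open>v # ws\<close>.\<close>

definition q_vec :: "'r ring \<Rightarrow> 'e list \<Rightarrow> ('e \<Rightarrow> 'r) list \<Rightarrow> 'e \<Rightarrow> 'r" where
  "q_vec R cs vs =
     (\<lambda>d. \<Oplus>\<^bsub>R\<^esub>i \<in> {..<length cs}. (hd vs) (cs ! i) \<otimes>\<^bsub>R\<^esub> (tl vs ! i) d)"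

definition pow_sig :: "'r ring \<Rightarrow> nat \<Rightarrow> ('r sm_sym + nu_sym) signature" where
  "pow_sig R n =
     \<lparr>symbols = sm_symbols R <+> symbols (nu n),
      arity = case_sum sm_arity (arity (nu n))\<rparr>"

definition pow_alg :: "'r ring \<Rightarrow> nat \<Rightarrow> ('r sm_sym + nu_sym, nat \<Rightarrow> 'r) ualg" where
  "pow_alg R n =
     \<lparr>carrier = free_vecs R {1..n},
      interp = case_sum (sm_interp R)
        (\<lambda>s vs. case s of Qop \<Rightarrow> q_vec R [1..<Suc n] vs | Ec i \<Rightarrow> unit_vec R i)\<rparr>"

definition Ce_pow :: "'r ring \<Rightarrow> nat \<Rightarrow> (nu_sym, nat \<Rightarrow> 'r) ualg" where
  "Ce_pow R n = Ce (pow_sig R n) (pow_alg R n) (Inr Qop) (map Inr (nu_consts n))"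


section \<open>Semiring powers\<close>

text \<open>The sum over all tuples \<open>(d\<^sub>1, \<dots>, d\<^sub>k)\<close> is taken over those with every \<open>d\<^sub>j\<close> in the support of
  \<open>v\<^sup>j\<close>, a finite set; the other summands are zero.\<close>

definition lift_op :: "'r ring \<Rightarrow> ('e list \<Rightarrow> 'e) \<Rightarrow> ('e \<Rightarrow> 'r) list \<Rightarrow> 'e \<Rightarrow> 'r" where
  "lift_op R g vs =
     (\<lambda>d. \<Oplus>\<^bsub>R\<^esub>ds \<in> listset (map (supp R) vs).
        foldr (\<lambda>(v, d) r. v d \<otimes>\<^bsub>R\<^esub> r) (zip vs ds) \<one>\<^bsub>R\<^esub> \<otimes>\<^bsub>R\<^esub> unit_vec R (g ds) d)"

text \<open>A finite nonempty set \<open>I = {c\<^sub>1, \<dots>, c\<^sub>m}\<close> is given by an enumeration without repetitions.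
  All enumerations are admitted; they yield the same operation up to the order of arguments.\<close>

definition enums :: "'e set \<Rightarrow> 'e list set" where
  "enums E = {cs. cs \<noteq> [] \<and> distinct cs \<and> set cs \<subseteq> E}"

datatype ('r, 'f, 'e) v_sym = VSm "'r sm_sym" | VLift 'f | VQ "'e list" | VConst 'e

definition V_sig :: "'f signature \<Rightarrow> ('f, 'e) ualg \<Rightarrow> 'r ring \<Rightarrow> ('r, 'f, 'e) v_sym signature" where
  "V_sig S E R =
     \<lparr>symbols = VSm ` sm_symbols R \<union> VLift ` symbols S \<union> VQ ` enums (carrier E)
                  \<union> VConst ` carrier E,
      arity = (\<lambda>s. case s of VSm t \<Rightarrow> sm_arity t | VLift g \<Rightarrow> arity S g
                 | VQ cs \<Rightarrow> Suc (length cs) | VConst d \<Rightarrow> 0)\<rparr>"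

definition V_alg :: "('f, 'e) ualg \<Rightarrow> 'r ring \<Rightarrow> (('r, 'f, 'e) v_sym, 'e \<Rightarrow> 'r) ualg" where
  "V_alg E R =
     \<lparr>carrier = free_vecs R (carrier E),
      interp = (\<lambda>s vs. case s of VSm t \<Rightarrow> sm_interp R t vs | VLift g \<Rightarrow> lift_op R (interp E g) vs
                 | VQ cs \<Rightarrow> q_vec R cs vs | VConst d \<Rightarrow> unit_vec R d)\<rparr>"

definition finitely_central :: "'f signature \<Rightarrow> ('f, 'e) ualg \<Rightarrow> 'r ring \<Rightarrow> ('e \<Rightarrow> 'r) \<Rightarrow> bool" where
  "finitely_central S E R v \<longleftrightarrow>
     (\<exists>cs \<in> enums (carrier E). n_central (V_sig S E R) (V_alg E R) (VQ cs) (map VConst cs) v)"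

definition semiring_power :: "'f signature \<Rightarrow> ('f, 'e) ualg \<Rightarrow> 'r ring \<Rightarrow> ('f, 'e \<Rightarrow> 'r) ualg" where
  "semiring_power S E R =
     \<lparr>carrier = {v. finitely_central S E R v},
      interp = (\<lambda>g. lift_op R (interp E g))\<rparr>"

end

theory Submission
  imports Defs
begin

text \<open>Centrality of \<open>c\<close> means that the congruences \<open>\<theta>(c, e\<^sub>i)\<close> intersect in the identity. By
  Zorn's lemma it follows that the homomorphisms \<open>\<eta>\<close> from \<open>A\<close> to \<open>\<^bold>n\<close> separate the points of \<open>A\<close>. In
  terms of these homomorphisms, \<open>B\<^sub>A\<close> consists of the elements with all values in \<open>{e\<^sub>1, e\<^sub>2}\<close>,
  and every \<open>\<eta>\<close> maps vectors over \<open>B\<^sub>A\<close> to vectors over the two-element semiring. The central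
  vectors are exactly those that every \<open>\<eta>\<close> maps to a basis vector, so a central vector is determined
  by the family of basis elements \<open>pt \<eta> v\<close>, and all operations act pointwise on these families:
  \<open>pt \<eta> (g(v\<^sup>1, \<dots>, v\<^sup>k)) = g(pt \<eta> v\<^sup>1, \<dots>, pt \<eta> v\<^sup>k)\<close>. The element \<open>a\<close> of \<open>A\<close> corresponds to
  the central vector with \<open>pt \<eta> v = \<eta> a\<close>. The retraction and its section are given by
  \<open>pt \<eta> (G v) = \<eta> (pt \<eta> v)\<close> and \<open>pt \<eta> (F v) = e\<^bsub>pt \<eta> v\<^esub>\<close>.\<close>

section \<open>Congruences and central elements\<close>

lemma in_listset_iff: "xs \<in> listset As \<longleftrightarrow> list_all2 (\<in>) xs As"
proof (induction As arbitrary: xs)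
  case (Cons A As)
  then show ?case by (cases xs) (auto simp: set_Cons_def)
qed simp

lemma finite_listset: "(\<And>A. A \<in> set As \<Longrightarrow> finite A) \<Longrightarrow> finite (listset As)"
proof (induction As)
  case (Cons A As)
  have "set_Cons A (listset As) = (\<lambda>(x, xs). x # xs) ` (A \<times> listset As)"
    by (auto simp: set_Cons_def)
  with Cons show ?case by simp
qed simp

section \<open>Congruences and the congruence generated by a pair\<close>

lemma congruenceI:
  assumes "equiv (carrier A) r"
    and "\<And>f xs ys. f \<in> symbols S \<Longrightarrow> xs \<in> args S A f \<Longrightarrow> list_all2 (\<lambda>x y. (x, y) \<in> r) xs ys \<Longrightarrow>
      (interp A f xs, interp A f ys) \<in> r"
  shows "congruence S A r"
  using assms by (simp add: congruence_def)

lemma congruence_equiv: "congruence S A r \<Longrightarrow> equiv (carrier A) r"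
  by (simp add: congruence_def)

lemma congruence_sym: "congruence S A r \<Longrightarrow> (x, y) \<in> r \<Longrightarrow> (y, x) \<in> r"
  by (auto simp: congruence_def equiv_def dest: symD)

lemma congruence_trans: "congruence S A r \<Longrightarrow> (x, y) \<in> r \<Longrightarrow> (y, z) \<in> r \<Longrightarrow> (x, z) \<in> r"
  by (auto simp: congruence_def equiv_def dest: transD)

lemma congruence_refl: "congruence S A r \<Longrightarrow> x \<in> carrier A \<Longrightarrow> (x, x) \<in> r"
  by (auto simp: congruence_def equiv_def dest: refl_onD)

lemma congruence_carrier:
  "congruence S A r \<Longrightarrow> (x, y) \<in> r \<Longrightarrow> x \<in> carrier A \<and> y \<in> carrier A"
  by (meson congruence_equiv equiv_class_eq_iff)

lemma congruence_interp:
  assumes "congruence S A r" "f \<in> symbols S" "length xs = arity S f"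
    and xy: "list_all2 (\<lambda>x y. (x, y) \<in> r) xs ys"
  shows "(interp A f xs, interp A f ys) \<in> r"
proof -
  have "set xs \<subseteq> carrier A" "set ys \<subseteq> carrier A"
    using xy congruence_carrier[OF assms(1)]
    by (fastforce simp: list_all2_conv_all_nth in_set_conv_nth)+
  moreover have "length ys = arity S f"
    using list_all2_lengthD[OF xy] assms(3) by simp
  ultimately show ?thesis
    using assms unfolding congruence_def args_def by blast
qed

lemma congruence_Id_on: "congruence S A {(x, y). x = y \<and> x \<in> carrier A}" if "ua_algebra S A"
proof -
  have "equiv (carrier A) {(x, y). x = y \<and> x \<in> carrier A}"
    by (auto intro!: equivI refl_onI symI transI)
  moreover have "(interp A f xs, interp A f ys) \<in> {(x, y). x = y \<and> x \<in> carrier A}"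
    if "f \<in> symbols S" "xs \<in> args S A f"
      and xy: "list_all2 (\<lambda>x y. (x, y) \<in> {(x, y). x = y \<and> x \<in> carrier A}) xs ys" for f xs ys
  proof -
    have "xs = ys"
      using xy by (auto simp: list_all2_conv_all_nth intro: nth_equalityI)
    with that show ?thesis
      using \<open>ua_algebra S A\<close> by (simp add: ua_algebra_def)
  qed
  ultimately show ?thesis
    by (rule congruenceI)
qed

lemma congruence_total: "ua_algebra S A \<Longrightarrow> congruence S A (carrier A \<times> carrier A)"
  by (auto simp: congruence_def ua_algebra_def intro!: equivI refl_onI symI transI)

lemma congruence_Inter:
  assumes "\<R> \<noteq> {}" "\<And>r. r \<in> \<R> \<Longrightarrow> congruence S A r"
  shows "congruence S A (\<Inter>\<R>)"
proof -
  have "equiv (carrier A) (\<Inter>\<R>)"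
  proof (intro equivI refl_onI symI transI)
    show "\<Inter>\<R> \<subseteq> carrier A \<times> carrier A"
      using assms congruence_carrier by fastforce
  qed (auto intro: congruence_refl[OF assms(2)] congruence_sym[OF assms(2)]
      congruence_trans[OF assms(2)])
  moreover have "(interp A f xs, interp A f ys) \<in> \<Inter>\<R>"
    if "f \<in> symbols S" "xs \<in> args S A f"
      and xy: "list_all2 (\<lambda>x y. (x, y) \<in> \<Inter>\<R>) xs ys" for f xs ys
  proof
    fix r assume "r \<in> \<R>"
    moreover have "list_all2 (\<lambda>x y. (x, y) \<in> r) xs ys"
      using xy \<open>r \<in> \<R>\<close> by (auto elim: list_all2_mono)
    ultimately show "(interp A f xs, interp A f ys) \<in> r"
      using that assms(2) by (auto intro: congruence_interp simp: args_def)
  qed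
  ultimately show ?thesis
    by (rule congruenceI)
qed

text \<open>The total relation is one of the congruences intersected, so the family is not
  empty.\<close>

lemma congruence_theta:
  assumes "ua_algebra S A" "a \<in> carrier A" "b \<in> carrier A"
  shows "congruence S A (theta S A a b)"
  unfolding theta_def using congruence_total[OF assms(1)] assms(2,3)
  by (intro congruence_Inter) auto

lemma theta_mem: "(a, b) \<in> theta S A a b"
  by (auto simp: theta_def)

lemma theta_least: "congruence S A r \<Longrightarrow> (a, b) \<in> r \<Longrightarrow> theta S A a b \<subseteq> r"
  by (auto simp: theta_def)

text \<open>Any two lists of representatives are congruent entry by entry, so all sets in the union
  defining the operation are one and the same class. The list \<open>xs\<close> is itself a choice
  of representatives, so the union is taken over a nonempty set.\<close>

lemma ua_quot_interp:
  assumes r: "congruence S A r" and f: "f \<in> symbols S" and xs: "xs \<in> args S A f"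
  shows "interp (ua_quot A r) f (map (\<lambda>x. r `` {x}) xs) = r `` {interp A f xs}"
proof -
  have eq: "r `` {interp A f ys} = r `` {interp A f xs}"
    if "ys \<in> listset (map (\<lambda>x. r `` {x}) xs)" for ys
  proof -
    have "list_all2 (\<lambda>x y. (x, y) \<in> r) xs ys"
      using that by (auto simp: in_listset_iff list_all2_conv_all_nth)
    then have "(interp A f xs, interp A f ys) \<in> r"
      using r f xs by (auto intro: congruence_interp simp: args_def)
    then show ?thesis
      using equiv_class_eq[OF congruence_equiv[OF r]] by blast
  qed
  have mem: "xs \<in> listset (map (\<lambda>x. r `` {x}) xs)"
    using xs congruence_refl[OF r]
    by (auto simp: in_listset_iff list_all2_conv_all_nth args_def subset_iff)
  have "(\<Union>ys \<in> listset (map (\<lambda>x. r `` {x}) xs). r `` {interp A f ys}) = r `` {interp A f xs}"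
    by (rule SUP_eq_const[OF _ eq]) (use mem in blast)
  then show ?thesis
    by (simp add: ua_quot_def)
qed

text \<open>Injectivity of the canonical map, expressed without quotients: the congruences
  \<theta>(c, e_i) meet in the equality relation.\<close>

definition separating :: "'f signature \<Rightarrow> ('f, 'a) ualg \<Rightarrow> 'f list \<Rightarrow> 'a \<Rightarrow> bool" where
  "separating S A es c \<longleftrightarrow> (\<forall>x \<in> carrier A. \<forall>y \<in> carrier A.
     (\<forall>i < length es. (x, y) \<in> theta S A c (interp A (es ! i) [])) \<longrightarrow> x = y)"

section \<open>Algebras with operations q, e_1, ..., e_n and the criterion for centrality\<close>

lemma has_dim_const:
  assumes "ua_algebra S A" "has_dim S A q es" "i < length es"
  shows "interp A (es ! i) [] \<in> carrier A"
  using assms by (auto simp: has_dim_def ua_algebra_def args_def)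

lemma has_dim_closed:
  assumes "ua_algebra S A" "has_dim S A q es" "c \<in> carrier A" "length bs = length es"
    "set bs \<subseteq> carrier A"
  shows "interp A q (c # bs) \<in> carrier A"
  using assms by (auto simp: has_dim_def ua_algebra_def args_def)

text \<open>The congruence replaces c by e_i, and q with first argument e_i is the i-th
  projection.\<close>

lemma theta_q:
  assumes A: "ua_algebra S A" and dim: "has_dim S A q es" and c: "c \<in> carrier A"
    and i: "i < length es" and bs: "length bs = length es" "set bs \<subseteq> carrier A"
  shows "(interp A q (c # bs), bs ! i) \<in> theta S A c (interp A (es ! i) [])"
proof -
  let ?t = "theta S A c (interp A (es ! i) [])"
  have t: "congruence S A ?t"
    by (intro congruence_theta A c has_dim_const[OF A dim i])
  have "list_all2 (\<lambda>x y. (x, y) \<in> ?t) bs bs"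
    using bs congruence_refl[OF t] by (auto simp: list_all2_conv_all_nth subset_iff)
  then have "(interp A q (c # bs), interp A q (interp A (es ! i) [] # bs)) \<in> ?t"
    using dim bs theta_mem by (intro congruence_interp[OF t]) (auto simp: has_dim_def)
  then show ?thesis
    using dim i bs by (simp add: has_dim_def)
qed

text \<open>Of the three conditions on the canonical map, only injectivity is not automatic: the element
  \<open>q(c, b\<^sub>1, \<dots>, b\<^sub>n)\<close> is a preimage of the tuple of classes of the \<open>b\<^sub>i\<close>.\<close>

lemma n_central_iff:
  assumes A: "ua_algebra S A"
  shows "n_central S A q es c \<longleftrightarrow> has_dim S A q es \<and> c \<in> carrier A \<and> separating S A es c"
proof (cases "has_dim S A q es \<and> c \<in> carrier A")
  case False
  then show ?thesis by (auto simp: n_central_def)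
next
  case True
  then have dim: "has_dim S A q es" and c: "c \<in> carrier A" by auto
  define t where "t i = theta S A c (interp A (es ! i) [])" for i
  define I where "I = {..<length es}"
  define \<phi> where "\<phi> = (\<lambda>x. \<lambda>i\<in>I. t i `` {x})"
  let ?P = "ua_prod I (\<lambda>i. ua_quot A (t i))"
  have t: "congruence S A (t i)" if "i \<in> I" for i
    using that unfolding t_def I_def
    by (intro congruence_theta A c has_dim_const[OF A dim]) auto
  have \<phi>: "\<phi> \<in> carrier A \<rightarrow> carrier ?P"
    by (auto simp: \<phi>_def ua_prod_def ua_quot_def intro: quotientI)
  have hom: "\<phi> \<in> ua_hom S A ?P"
  proof -
    have "\<phi> (interp A f xs) = interp ?P f (map \<phi> xs)" if "f \<in> symbols S" "xs \<in> args S A f" for f xs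
    proof
      fix i
      show "\<phi> (interp A f xs) i = interp ?P f (map \<phi> xs) i"
      proof (cases "i \<in> I")
        case True
        have "interp ?P f (map \<phi> xs) i = interp (ua_quot A (t i)) f (map (\<lambda>x. t i `` {x}) xs)"
          using True by (simp add: ua_prod_def \<phi>_def comp_def)
        with ua_quot_interp[OF t that] True show ?thesis
          by (simp add: \<phi>_def)
      qed (simp add: \<phi>_def ua_prod_def)
    qed
    with \<phi> show ?thesis by (auto simp: ua_hom_def)
  qed
  have surj: "\<phi> ` carrier A = carrier ?P"
  proof
    show "carrier ?P \<subseteq> \<phi> ` carrier A"
    proof
      fix Y assume Y: "Y \<in> carrier ?P"
      then have "\<exists>b. \<forall>i\<in>I. b i \<in> carrier A \<and> Y i = t i `` {b i}"
        by (intro bchoice) (auto simp: ua_prod_def ua_quot_def PiE_iff quotient_def)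
      then obtain b where b: "\<And>i. i \<in> I \<Longrightarrow> b i \<in> carrier A \<and> Y i = t i `` {b i}"
        by blast
      define bs where "bs = map b [0..<length es]"
      have bs: "length bs = length es" "set bs \<subseteq> carrier A"
        using b by (auto simp: bs_def I_def)
      have "\<phi> (interp A q (c # bs)) i = Y i" for i
      proof (cases "i \<in> I")
        case True
        then have "(interp A q (c # bs), b i) \<in> t i"
          using theta_q[OF A dim c _ bs, of i] by (simp add: bs_def I_def t_def)
        with True show ?thesis
          using equiv_class_eq[OF congruence_equiv[OF t[OF True]]] b by (simp add: \<phi>_def)
      next
        case False
        with Y show ?thesis by (auto simp: \<phi>_def ua_prod_def PiE_def extensional_def)
      qed
      then show "Y \<in> \<phi> ` carrier A"
        using has_dim_closed[OF A dim c bs] by (metis ext imageI)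
    qed
  qed (use \<phi> in auto)
  have "inj_on \<phi> (carrier A) \<longleftrightarrow> separating S A es c"
  proof -
    have "\<phi> x = \<phi> y \<longleftrightarrow> (\<forall>i < length es. (x, y) \<in> t i)" if "x \<in> carrier A" "y \<in> carrier A" for x y
    proof -
      have "\<phi> x = \<phi> y \<longleftrightarrow> (\<forall>i\<in>I. t i `` {x} = t i `` {y})"
        by (auto simp: \<phi>_def fun_eq_iff restrict_def)
      then show ?thesis
        using eq_equiv_class_iff[OF congruence_equiv[OF t]] that by (auto simp: I_def)
    qed
    then show ?thesis by (auto simp: inj_on_def separating_def t_def)
  qed
  moreover have "n_central S A q es c \<longleftrightarrow> \<phi> \<in> ua_iso S A ?P"
    using dim c by (simp add: n_central_def \<phi>_def t_def I_def)
  ultimately show ?thesis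
    using dim c hom surj by (simp add: ua_iso_def bij_betw_def)
qed

section \<open>Separation of points by homomorphisms\<close>

text \<open>Zorn's lemma applies because operations are finitary: finitely many pairs in the union
  of a chain already lie in one member, so the union of a nonempty chain is again a congruence, and
  it still avoids the pair.\<close>

lemma maximal_congruence_avoiding:
  assumes A: "ua_algebra S A" and "a \<noteq> b"
  obtains r where "congruence S A r" "(a, b) \<notin> r"
    "\<And>s. congruence S A s \<Longrightarrow> (a, b) \<notin> s \<Longrightarrow> r \<subseteq> s \<Longrightarrow> s = r"
proof -
  define \<R> where "\<R> = {r. congruence S A r \<and> (a, b) \<notin> r}"
  have "\<exists>M\<in>\<R>. \<forall>X\<in>\<R>. M \<subseteq> X \<longrightarrow> X = M"
  proof (rule subset_Zorn_nonempty)
    show "\<R> \<noteq> {}"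
      using congruence_Id_on[OF A] \<open>a \<noteq> b\<close> by (auto simp: \<R>_def)
  next
    fix \<C> assume ne: "\<C> \<noteq> {}" and chain: "subset.chain \<R> \<C>"
    have cong: "congruence S A r" if "r \<in> \<C>" for r
      using chain that by (auto simp: subset.chain_def \<R>_def)
    have two: "\<exists>r\<in>\<C>. (x, y) \<in> r \<and> (x', y') \<in> r" if "(x, y) \<in> \<Union>\<C>" "(x', y') \<in> \<Union>\<C>" for x y x' y'
      using finite_subset_Union_chain[OF _ _ ne chain, of "{(x, y), (x', y')}"] that by auto
    have "equiv (carrier A) (\<Union>\<C>)"
    proof (intro equivI refl_onI symI transI)
      show "\<Union>\<C> \<subseteq> carrier A \<times> carrier A"
        using congruence_carrier[OF cong] by fastforce
      show "(x, x) \<in> \<Union>\<C>" if "x \<in> carrier A" for x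
        using that ne congruence_refl[OF cong] by blast
      show "(y, x) \<in> \<Union>\<C>" if "(x, y) \<in> \<Union>\<C>" for x y
        using that congruence_sym[OF cong] by blast
      show "(x, z) \<in> \<Union>\<C>" if "(x, y) \<in> \<Union>\<C>" "(y, z) \<in> \<Union>\<C>" for x y z
        using two[OF that] congruence_trans[OF cong] by blast
    qed
    moreover have "(interp A f xs, interp A f ys) \<in> \<Union>\<C>"
      if f: "f \<in> symbols S" "xs \<in> args S A f" and xy: "list_all2 (\<lambda>x y. (x, y) \<in> \<Union>\<C>) xs ys" for f xs ys
    proof -
      have "set (zip xs ys) \<subseteq> \<Union>\<C>"
        using xy by (auto simp: list_all2_iff)
      then obtain r where r: "r \<in> \<C>" "set (zip xs ys) \<subseteq> r"
        using finite_subset_Union_chain[OF _ _ ne chain] by (metis List.finite_set)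
      then have "list_all2 (\<lambda>x y. (x, y) \<in> r) xs ys"
        using xy by (auto simp: list_all2_iff)
      then have "(interp A f xs, interp A f ys) \<in> r"
        using f by (intro congruence_interp[OF cong[OF r(1)]]) (auto simp: args_def)
      with r show ?thesis by blast
    qed
    ultimately have "congruence S A (\<Union>\<C>)"
      by (rule congruenceI)
    then show "\<Union>\<C> \<in> \<R>"
      using chain by (auto simp: \<R>_def subset.chain_def)
  qed
  with that show ?thesis
    by (auto simp: \<R>_def)
qed

section \<open>The congruences \<theta>(c, e_i) of a pure Boolean-like algebra\<close>

locale pure_bla =
  fixes n :: nat and A :: "(nu_sym, 'a) ualg"
  assumes n2: "n \<ge> 2" and bla: "pure_boolean_like n A"
begin

abbreviation e :: "nat \<Rightarrow> 'a" where "e i \<equiv> interp A (Ec i) []"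
abbreviation q :: "'a list \<Rightarrow> 'a" where "q \<equiv> interp A Qop"
abbreviation th :: "'a \<Rightarrow> nat \<Rightarrow> ('a \<times> 'a) set" where "th c i \<equiv> theta (nu n) A c (e i)"

lemma A: "ua_algebra (nu n) A" and dim: "has_dim (nu n) A Qop (nu_consts n)"
  using bla by (auto simp: pure_boolean_like_def pure_algebra_def)

text \<open>List positions start at 0 while the constants are numbered from 1. Hence
  \<open>i - 1\<close> below wherever an index from 1 to n serves as a position in a list without
  the selecting first argument.\<close>

lemma nu_consts_nth: "i < n \<Longrightarrow> nu_consts n ! i = Ec (Suc i)"
  by (simp del: upt_Suc)

lemma e_closed: "i \<in> {1..n} \<Longrightarrow> e i \<in> carrier A"
  using A by (auto simp: ua_algebra_def nu_def args_def)

lemma q_closed: "length xs = Suc n \<Longrightarrow> set xs \<subseteq> carrier A \<Longrightarrow> q xs \<in> carrier A"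
  using A by (auto simp: ua_algebra_def nu_def args_def)

lemma q_e:
  assumes "i \<in> {1..n}" "length bs = n" "set bs \<subseteq> carrier A"
  shows "q (e i # bs) = bs ! (i - 1)"
proof -
  have "\<forall>i<n. \<forall>bs. length bs = n \<and> set bs \<subseteq> carrier A \<longrightarrow> q (interp A (nu_consts n ! i) [] # bs) = bs ! i"
    using dim by (auto simp: has_dim_def simp del: upt_Suc)
  then show ?thesis
    using assms nu_consts_nth[of "i - 1"] by (auto dest: spec[of _ "i - 1"] simp del: upt_Suc)
qed

lemma congruence_q:
  assumes "congruence (nu n) A r" "length xs = Suc n" "list_all2 (\<lambda>x y. (x, y) \<in> r) xs ys"
  shows "(q xs, q ys) \<in> r"
  using assms by (intro congruence_interp[OF assms(1)]) (auto simp: nu_def)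

lemma congruence_th: "c \<in> carrier A \<Longrightarrow> i \<in> {1..n} \<Longrightarrow> congruence (nu n) A (th c i)"
  by (intro congruence_theta A e_closed)

lemma th_separate:
  assumes "c \<in> carrier A" "x \<in> carrier A" "y \<in> carrier A" "\<And>i. i \<in> {1..n} \<Longrightarrow> (x, y) \<in> th c i"
  shows "x = y"
proof -
  have "separating (nu n) A (nu_consts n) c"
    using bla assms(1) n_central_iff[OF A] by (simp add: pure_boolean_like_def)
  moreover have "(x, y) \<in> theta (nu n) A c (interp A (nu_consts n ! i) [])" if "i < n" for i
    using assms(4)[of "Suc i"] that by (simp add: nu_consts_nth del: upt_Suc)
  ultimately show ?thesis
    using assms(2,3) by (auto simp: separating_def simp del: upt_Suc)
qed

lemma th_q:
  assumes "c \<in> carrier A" "i \<in> {1..n}" "length bs = n" "set bs \<subseteq> carrier A"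
  shows "(q (c # bs), bs ! (i - 1)) \<in> th c i"
  using theta_q[OF A dim assms(1), of "i - 1" bs] assms nu_consts_nth[of "i - 1"]
  by (auto simp del: upt_Suc)

text \<open>In the product of the quotients A/\<theta>(c, e_k) this element has the i-th coordinate
  of x and the coordinates of e_1 elsewhere. So \<open>U c i\<close> is the projection to the i-th
  factor, realised inside A with \<open>e 1\<close> as base point.\<close>

definition U :: "'a \<Rightarrow> nat \<Rightarrow> 'a \<Rightarrow> 'a" where
  "U c i x = q (c # (replicate n (e 1))[i - 1 := x])"

lemma set_U_args: "x \<in> carrier A \<Longrightarrow> set ((replicate n (e 1))[i := x]) \<subseteq> carrier A"
  using set_update_subset_insert[of "replicate n (e 1)" i x] e_closed[of 1] n2 by auto

lemma U_closed: "c \<in> carrier A \<Longrightarrow> x \<in> carrier A \<Longrightarrow> U c i x \<in> carrier A"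
  unfolding U_def using set_U_args by (intro q_closed) auto

lemma th_U:
  assumes "c \<in> carrier A" "x \<in> carrier A" "i \<in> {1..n}" "k \<in> {1..n}"
  shows "(U c i x, if k = i then x else e 1) \<in> th c k"
proof -
  have "(replicate n (e 1))[i - 1 := x] ! (k - 1) = (if k = i then x else e 1)"
    using assms by (auto simp: nth_list_update)
  then show ?thesis
    using th_q[OF assms(1,4) _ set_U_args[OF assms(2)], of "i - 1"] by (simp add: U_def)
qed

text \<open>By \<open>th_separate\<close> it suffices to compare modulo each \<theta>(c, e_k). There
  \<open>U c i\<close> is the identity for k = i and the constant map to e_1 otherwise, and e_1 is
  idempotent for q.\<close>

lemma U_q:
  assumes c: "c \<in> carrier A" and i: "i \<in> {1..n}" and xs: "length xs = Suc n" "set xs \<subseteq> carrier A"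
  shows "U c i (q xs) = q (map (U c i) xs)"
proof (rule th_separate[OF c])
  show "U c i (q xs) \<in> carrier A"
    using c xs by (intro U_closed q_closed)
  show "q (map (U c i) xs) \<in> carrier A"
    using c xs by (intro q_closed) (auto intro!: U_closed)
  fix k assume k: "k \<in> {1..n}"
  have th: "congruence (nu n) A (th c k)"
    using c k by (rule congruence_th)
  let ?ys = "map (\<lambda>x. if k = i then x else e 1) xs"
  have "list_all2 (\<lambda>x y. (x, y) \<in> th c k) (map (U c i) xs) ?ys"
    using th_U[OF c _ i k] xs by (auto simp: list_all2_conv_all_nth subset_iff)
  then have *: "(q (map (U c i) xs), q ?ys) \<in> th c k"
    using xs by (intro congruence_q[OF th]) auto
  have ys: "q ?ys = (if k = i then q xs else e 1)"
  proof (cases "k = i")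
    case False
    then have "?ys = e 1 # replicate n (e 1)"
      using xs(1) by (simp add: map_replicate_const)
    moreover have "q (e 1 # replicate n (e 1)) = e 1"
      using q_e[of 1 "replicate n (e 1)"] e_closed[of 1] n2 by auto
    ultimately show ?thesis using False by simp
  qed simp
  show "(U c i (q xs), q (map (U c i) xs)) \<in> th c k"
    by (rule congruence_trans[OF th th_U[OF c q_closed[OF xs] i k]
          congruence_sym[OF th *[unfolded ys]]])
qed

text \<open>Modulo \<theta>(c, e_i) both sides reduce to the common class of c and e_i, modulo the
  other congruences to e_1. This puts \<open>(c, e i)\<close> into the congruence pulled back along
  \<open>U c i\<close> in \<open>H_separate\<close>.\<close>

lemma U_self:
  assumes c: "c \<in> carrier A" and i: "i \<in> {1..n}"
  shows "U c i c = U c i (e i)"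
proof (rule th_separate[OF c])
  fix k assume k: "k \<in> {1..n}"
  have th: "congruence (nu n) A (th c k)"
    using c k by (rule congruence_th)
  have "(if k = i then c else e 1, if k = i then e i else e 1) \<in> th c k"
    using theta_mem congruence_refl[OF th] e_closed[of 1] n2 by auto
  then show "(U c i c, U c i (e i)) \<in> th c k"
    by (intro congruence_trans[OF th th_U[OF c c i k]]
        congruence_trans[OF th _ congruence_sym[OF th th_U[OF c e_closed[OF i] i k]]])
qed (use assms U_closed e_closed in auto)

text \<open>Reassembly of x from its components: modulo \<theta>(c, e_k) the operation q selects
  \<open>U c k x\<close>, which is congruent to x there.\<close>

lemma q_U:
  assumes c: "c \<in> carrier A" and x: "x \<in> carrier A"
  shows "q (c # map (\<lambda>i. U c i x) [1..<Suc n]) = x"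
proof (rule th_separate[OF c])
  let ?us = "map (\<lambda>i. U c i x) [1..<Suc n]"
  have us: "set ?us \<subseteq> carrier A" "length ?us = n"
    using U_closed c x by (auto simp del: upt_Suc)
  show "q (c # ?us) \<in> carrier A"
    using us c by (intro q_closed) (auto simp del: upt_Suc)
  fix k assume k: "k \<in> {1..n}"
  have th: "congruence (nu n) A (th c k)"
    using c k by (rule congruence_th)
  have "?us ! (k - 1) = U c k x"
    using k by (auto simp del: upt_Suc)
  then have "(q (c # ?us), U c k x) \<in> th c k"
    using th_q[OF c k us(2,1)] by simp
  moreover have "(U c k x, x) \<in> th c k"
    using th_U[OF c x k k] by simp
  ultimately show "(q (c # ?us), x) \<in> th c k"
    by (rule congruence_trans[OF th])
qed (rule x)

definition H :: "('a \<Rightarrow> nat) set" where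
  "H = ua_hom (nu n) A (n_alg n)"

text \<open>A congruence maximal among those not identifying \<open>a\<close> and \<open>b\<close> has quotient \<open>\<^bold>n\<close>: the
  congruences \<open>r\<^sub>i = {(x, y). U c i x r U c i y}\<close> contain \<open>r\<close> and \<open>(c, e\<^sub>i)\<close> and intersect in \<open>r\<close>,
  so one of them equals \<open>r\<close>.\<close>

lemma H_separate:
  assumes ab: "a \<in> carrier A" "b \<in> carrier A" "a \<noteq> b"
  shows "\<exists>\<eta>\<in>H. \<eta> a \<noteq> \<eta> b"
proof -
  obtain r where r: "congruence (nu n) A r" and nab: "(a, b) \<notin> r"
    and max: "\<And>s. congruence (nu n) A s \<Longrightarrow> (a, b) \<notin> s \<Longrightarrow> r \<subseteq> s \<Longrightarrow> s = r"
    using maximal_congruence_avoiding[OF A ab(3)] by blast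
  have ex: "\<exists>i\<in>{1..n}. (c, e i) \<in> r" if c: "c \<in> carrier A" for c
  proof -
    define s where "s i = {(x, y). x \<in> carrier A \<and> y \<in> carrier A \<and> (U c i x, U c i y) \<in> r}" for i
    have cong: "congruence (nu n) A (s i)" if i: "i \<in> {1..n}" for i
    proof (rule congruenceI)
      show "equiv (carrier A) (s i)"
        using r U_closed[OF c] unfolding s_def
        by (intro equivI refl_onI symI transI)
          (auto intro: congruence_refl congruence_sym congruence_trans)
      fix f xs ys
      assume f: "f \<in> symbols (nu n)" "xs \<in> args (nu n) A f"
        and xy: "list_all2 (\<lambda>x y. (x, y) \<in> s i) xs ys"
      show "(interp A f xs, interp A f ys) \<in> s i"
      proof (cases f)
        case Qop
        have xs: "length xs = Suc n" "set xs \<subseteq> carrier A"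
          using f Qop by (auto simp: args_def nu_def)
        have ys: "length ys = Suc n" "set ys \<subseteq> carrier A"
          using xy xs by (auto simp: list_all2_conv_all_nth s_def in_set_conv_nth)
        have "list_all2 (\<lambda>x y. (x, y) \<in> r) (map (U c i) xs) (map (U c i) ys)"
          using xy by (auto simp: list_all2_conv_all_nth s_def)
        then have "(q (map (U c i) xs), q (map (U c i) ys)) \<in> r"
          using xs by (intro congruence_q[OF r]) auto
        then show ?thesis
          using U_q[OF c i] xs ys q_closed by (simp add: s_def Qop)
      next
        case (Ec j)
        \<comment> \<open>Without arguments the two values are the same constant, so reflexivity
          suffices; \<open>U c i\<close> need not fix that constant.\<close>
        then have "xs = []" "ys = []" "j \<in> {1..n}"
          using f xy by (auto simp: args_def nu_def)
        then show ?thesis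
          using congruence_refl[OF r] U_closed[OF c] e_closed Ec by (simp add: s_def)
      qed
    qed
    \<comment> \<open>\<open>U c i\<close> is a polynomial operation of A, hence respected by every
      congruence.\<close>
    have sub: "r \<subseteq> s i" if i: "i \<in> {1..n}" for i
    proof
      fix z assume "z \<in> r"
      then obtain x y where z: "z = (x, y)" "(x, y) \<in> r" by (cases z) auto
      then have xy: "x \<in> carrier A" "y \<in> carrier A"
        using congruence_carrier[OF r] by auto
      have "list_all2 (\<lambda>x y. (x, y) \<in> r) (c # (replicate n (e 1))[i - 1 := x])
              (c # (replicate n (e 1))[i - 1 := y])"
        using z c congruence_refl[OF r] e_closed[of 1] n2
        by (auto intro!: list_all2_update_cong simp: list.rel_refl_strong list_all2_same)
      then have "(U c i x, U c i y) \<in> r"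
        unfolding U_def by (intro congruence_q[OF r]) auto
      with z xy show "z \<in> s i" by (simp add: s_def)
    qed
    \<comment> \<open>If \<open>(a, b)\<close> were in every \<open>s i\<close>, all components of a
      and b would be r-related, and reassembling them by \<open>q_U\<close> would relate a and
      b.\<close>
    have "\<exists>i\<in>{1..n}. (a, b) \<notin> s i"
    proof (rule ccontr)
      assume "\<not> ?thesis"
      then have "list_all2 (\<lambda>x y. (x, y) \<in> r) (c # map (\<lambda>i. U c i a) [1..<Suc n])
          (c # map (\<lambda>i. U c i b) [1..<Suc n])"
        using congruence_refl[OF r c]
        by (auto simp: list_all2_conv_all_nth nth_Cons s_def simp del: upt_Suc split: nat.split)
      then have "(q (c # map (\<lambda>i. U c i a) [1..<Suc n]), q (c # map (\<lambda>i. U c i b) [1..<Suc n])) \<in> r"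
        by (intro congruence_q[OF r]) (auto simp del: upt_Suc)
      with nab show False
        using q_U[OF c] ab by simp
    qed
    then obtain i where i: "i \<in> {1..n}" "(a, b) \<notin> s i" by blast
    have "(c, e i) \<in> s i"
      using U_self[OF c i(1)] congruence_refl[OF r U_closed[OF c e_closed[OF i(1)]]] c e_closed[OF i(1)]
      by (simp add: s_def)
    then show ?thesis
      using max[OF cong[OF i(1)] i(2) sub[OF i(1)]] i(1) by auto
  qed
  have uniq: "i = j" if ij: "i \<in> {1..n}" "j \<in> {1..n}" and eij: "(e i, e j) \<in> r" for i j
  proof (rule ccontr)
    assume "i \<noteq> j"
    \<comment> \<open>With a in place i and b in all others, q(e_i, bs) = a and q(e_j, bs) = b, so
      relating the two constants would relate a and b.\<close>
    define bs where "bs = (replicate n b)[i - 1 := a]"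
    have bs: "set bs \<subseteq> carrier A" "length bs = n"
      using set_update_subset_insert[of "replicate n b" "i - 1" a] ab by (auto simp: bs_def)
    have "list_all2 (\<lambda>x y. (x, y) \<in> r) (e i # bs) (e j # bs)"
      using eij bs congruence_refl[OF r] by (auto simp: list_all2_conv_all_nth nth_Cons subset_iff split: nat.split)
    then have "(q (e i # bs), q (e j # bs)) \<in> r"
      using bs by (intro congruence_q[OF r]) auto
    moreover have "q (e i # bs) = a" "q (e j # bs) = b"
      using q_e[OF ij(1) bs(2,1)] q_e[OF ij(2) bs(2,1)] ij \<open>i \<noteq> j\<close>
      by (auto simp: bs_def nth_list_update)
    ultimately show False using nab by simp
  qed
  \<comment> \<open>By \<open>ex\<close> and \<open>uniq\<close> each class of r contains exactly
    one constant; \<eta> returns its index.\<close>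
  have "\<forall>c\<in>carrier A. \<exists>i. i \<in> {1..n} \<and> (c, e i) \<in> r"
    using ex by blast
  then obtain \<eta> where \<eta>: "\<And>c. c \<in> carrier A \<Longrightarrow> \<eta> c \<in> {1..n} \<and> (c, e (\<eta> c)) \<in> r"
    using bchoice[of "carrier A" "\<lambda>c i. i \<in> {1..n} \<and> (c, e i) \<in> r"] by blast
  have \<eta>_eq: "\<eta> c = i" if "c \<in> carrier A" "i \<in> {1..n}" "(c, e i) \<in> r" for c i
  proof (rule uniq)
    show "(e (\<eta> c), e i) \<in> r"
      using that \<eta>[of c] by (blast intro: congruence_trans[OF r congruence_sym[OF r]])
  qed (use that \<eta>[of c] in auto)
  have "\<eta> \<in> H"
  proof -
    have "\<eta> (interp A f xs) = interp (n_alg n) f (map \<eta> xs)"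
      if f: "f \<in> symbols (nu n)" "xs \<in> args (nu n) A f" for f xs
    proof (cases f)
      case Qop
      then obtain c bs where xs: "xs = c # bs" "length bs = n" "set bs \<subseteq> carrier A" "c \<in> carrier A"
        using f by (cases xs) (auto simp: args_def nu_def)
      let ?i = "\<eta> c" let ?b = "bs ! (?i - 1)"
      have i: "?i \<in> {1..n}" "(c, e ?i) \<in> r" using \<eta> xs by auto
      have b: "?b \<in> carrier A" using i xs by (auto simp: subset_iff)
      have "list_all2 (\<lambda>x y. (x, y) \<in> r) (c # bs) (e ?i # bs)"
        using i xs congruence_refl[OF r]
        by (auto simp: list_all2_conv_all_nth nth_Cons subset_iff split: nat.split)
      then have "(q xs, q (e ?i # bs)) \<in> r"
        using xs by (auto intro: congruence_q[OF r])
      then have "(q xs, ?b) \<in> r"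
        using q_e[OF i(1) xs(2,3)] by simp
      then have "(q xs, e (\<eta> ?b)) \<in> r"
        using \<eta>[OF b] congruence_trans[OF r] by blast
      then have "\<eta> (q xs) = \<eta> ?b"
        using \<eta>[OF b] xs by (intro \<eta>_eq q_closed) auto
      then show ?thesis
        using i xs Qop by (auto simp: n_alg_def nth_Cons')
    next
      case (Ec j)
      then have j: "xs = []" "j \<in> {1..n}"
        using f by (auto simp: args_def nu_def)
      then show ?thesis
        using \<eta>_eq[OF e_closed[OF j(2)] j(2)] congruence_refl[OF r e_closed[OF j(2)]] Ec
        by (simp add: n_alg_def)
    qed
    then show ?thesis
      using \<eta> by (auto simp: H_def ua_hom_def n_alg_def)
  qed
  moreover have "\<eta> a \<noteq> \<eta> b"
  proof
    assume "\<eta> a = \<eta> b"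
    then have "(a, e (\<eta> a)) \<in> r" "(b, e (\<eta> a)) \<in> r"
      using \<eta>[OF ab(1)] \<eta>[OF ab(2)] by auto
    then show False
      using nab congruence_trans[OF r _ congruence_sym[OF r]] by blast
  qed
  ultimately show ?thesis by blast
qed

end

section \<open>Vectors over a separated semiring\<close>

text \<open>\<open>X\<close> indexes a point-separating family of homomorphisms from \<open>R\<close> to the two-element Boolean
  semiring; \<open>T \<chi> x\<close> says that the homomorphism \<open>\<chi>\<close> maps \<open>x\<close> to \<open>1\<close>.\<close>

locale separated_semiring =
  fixes R :: "'r ring" (structure) and X :: "'x set" and T :: "'x \<Rightarrow> 'r \<Rightarrow> bool"
  assumes zero_closed [simp]: "\<zero> \<in> carrier R" and one_closed [simp]: "\<one> \<in> carrier R"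
    and add_closed [simp]: "x \<in> carrier R \<Longrightarrow> y \<in> carrier R \<Longrightarrow> x \<oplus> y \<in> carrier R"
    and mult_closed [simp]: "x \<in> carrier R \<Longrightarrow> y \<in> carrier R \<Longrightarrow> x \<otimes> y \<in> carrier R"
    and T_zero [simp]: "\<chi> \<in> X \<Longrightarrow> \<not> T \<chi> \<zero>" and T_one [simp]: "\<chi> \<in> X \<Longrightarrow> T \<chi> \<one>"
    and T_add [simp]: "\<chi> \<in> X \<Longrightarrow> x \<in> carrier R \<Longrightarrow> y \<in> carrier R \<Longrightarrow> T \<chi> (x \<oplus> y) \<longleftrightarrow> T \<chi> x \<or> T \<chi> y"
    and T_mult [simp]: "\<chi> \<in> X \<Longrightarrow> x \<in> carrier R \<Longrightarrow> y \<in> carrier R \<Longrightarrow> T \<chi> (x \<otimes> y) \<longleftrightarrow> T \<chi> x \<and> T \<chi> y"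
    and T_ext: "x \<in> carrier R \<Longrightarrow> y \<in> carrier R \<Longrightarrow> (\<And>\<chi>. \<chi> \<in> X \<Longrightarrow> T \<chi> x \<longleftrightarrow> T \<chi> y) \<Longrightarrow> x = y"
begin

text \<open>The laws of disjunction hold at each \<chi> and are transferred to R by
  \<open>T_ext\<close>.\<close>

lemma abelian_monoid_R: "abelian_monoid R"
  by (rule abelian_monoidI) (auto intro!: T_ext)

lemmas finsum_closed = abelian_monoid.finsum_closed[OF abelian_monoid_R]
  and finsum_empty = abelian_monoid.finsum_empty[OF abelian_monoid_R]
  and finsum_insert = abelian_monoid.finsum_insert[OF abelian_monoid_R]

lemma T_finsum:
  assumes "\<chi> \<in> X" "finite F" "f \<in> F \<rightarrow> carrier R"
  shows "T \<chi> (finsum R f F) \<longleftrightarrow> (\<exists>i\<in>F. T \<chi> (f i))"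
  using assms(2,3)
proof (induction F)
  case empty
  then show ?case using assms(1) by (simp add: finsum_empty)
next
  case (insert i F)
  then have "f \<in> F \<rightarrow> carrier R" "f i \<in> carrier R" by auto
  with insert show ?case using assms(1) by (simp add: finsum_closed finsum_insert)
qed

section \<open>Free vectors and their operations, evaluated at each \<chi>\<close>

lemma free_vecs_closed: "v \<in> free_vecs R E \<Longrightarrow> v d \<in> carrier R"
  by (auto simp: free_vecs_def)

lemma free_vecs_supp:
  "v \<in> free_vecs R E \<Longrightarrow> supp R v \<subseteq> E" "v \<in> free_vecs R E \<Longrightarrow> finite (supp R v)"
  by (auto simp: free_vecs_def)

lemma T_supp: "\<chi> \<in> X \<Longrightarrow> T \<chi> (v d) \<Longrightarrow> d \<in> supp R v"
  using T_zero by (auto simp: supp_def)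

lemma vec_ext:
  assumes "v \<in> free_vecs R E" "w \<in> free_vecs R E'" "\<And>\<chi> d. \<chi> \<in> X \<Longrightarrow> T \<chi> (v d) \<longleftrightarrow> T \<chi> (w d)"
  shows "v = w"
  by (rule ext, rule T_ext) (use assms free_vecs_closed in auto)

text \<open>An entry that is false at every \<chi> is zero by \<open>T_ext\<close>, so a common
  bound F for the supports at all \<chi> bounds the support of v.\<close>

lemma free_vecsI:
  assumes "\<And>d. v d \<in> carrier R" "finite F" "F \<subseteq> E" "\<And>\<chi> d. \<chi> \<in> X \<Longrightarrow> T \<chi> (v d) \<Longrightarrow> d \<in> F"
  shows "v \<in> free_vecs R E"
proof -
  have "v d = \<zero>" if "d \<notin> F" for d
    using assms(1,4) that by (intro T_ext) auto
  then have "supp R v \<subseteq> F"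
    by (auto simp: supp_def)
  with assms show ?thesis
    by (auto simp: free_vecs_def intro: finite_subset)
qed

lemma T_unit_vec [simp]: "\<chi> \<in> X \<Longrightarrow> T \<chi> (unit_vec R d d') \<longleftrightarrow> d' = d"
  by (simp add: unit_vec_def)

lemma unit_vec_free: "d \<in> E \<Longrightarrow> unit_vec R d \<in> free_vecs R E"
  by (rule free_vecsI[of _ "{d}"]) (auto simp: unit_vec_def split: if_splits)

lemma zero_vec_free: "(\<lambda>d. \<zero>) \<in> free_vecs R E"
  by (rule free_vecsI[of _ "{}"]) auto

lemma q_vec_closed:
  assumes "range v \<subseteq> carrier R" "length ws = length cs" "\<And>w. w \<in> set ws \<Longrightarrow> range w \<subseteq> carrier R"
  shows "q_vec R cs (v # ws) d \<in> carrier R"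
  unfolding q_vec_def using assms by (intro finsum_closed) (auto simp: image_subset_iff)

lemma T_q_vec:
  assumes "\<chi> \<in> X" "range v \<subseteq> carrier R" "length ws = length cs"
    "\<And>w. w \<in> set ws \<Longrightarrow> range w \<subseteq> carrier R"
  shows "T \<chi> (q_vec R cs (v # ws) d) \<longleftrightarrow> (\<exists>i < length cs. T \<chi> (v (cs ! i)) \<and> T \<chi> ((ws ! i) d))"
proof -
  have c: "v x \<in> carrier R" "i < length cs \<Longrightarrow> (ws ! i) x \<in> carrier R" for i x
    using assms by (auto simp: image_subset_iff)
  have "T \<chi> (q_vec R cs (v # ws) d) \<longleftrightarrow> (\<exists>i\<in>{..<length cs}. T \<chi> (v (cs ! i) \<otimes> (ws ! i) d))"
    unfolding q_vec_def list.sel using assms(1) c by (intro T_finsum) auto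
  with assms(1) c show ?thesis by auto
qed

lemma q_vec_free:
  assumes "v \<in> free_vecs R E" "length ws = length cs" "set ws \<subseteq> free_vecs R E"
  shows "q_vec R cs (v # ws) \<in> free_vecs R E"
proof (rule free_vecsI[of _ "\<Union> (supp R ` set ws)"])
  have c: "range v \<subseteq> carrier R" "\<And>w. w \<in> set ws \<Longrightarrow> range w \<subseteq> carrier R"
    using assms by (auto simp: free_vecs_def)
  show "q_vec R cs (v # ws) d \<in> carrier R" for d
    using c assms(2) by (intro q_vec_closed)
  show "d \<in> \<Union> (supp R ` set ws)" if "\<chi> \<in> X" "T \<chi> (q_vec R cs (v # ws) d)" for \<chi> d
    using that T_q_vec[OF that(1) c(1) assms(2) c(2)] assms(2) T_supp[OF that(1)]
    by (metis UN_I nth_mem)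
qed (use assms in \<open>auto simp: free_vecs_def\<close>)

lemma lift_coeff:
  assumes "length vs = length ds" "\<And>v. v \<in> set vs \<Longrightarrow> range v \<subseteq> carrier R"
  shows "foldr (\<lambda>(v, d) r. v d \<otimes> r) (zip vs ds) \<one> \<in> carrier R \<and>
    (\<forall>\<chi>\<in>X. T \<chi> (foldr (\<lambda>(v, d) r. v d \<otimes> r) (zip vs ds) \<one>) \<longleftrightarrow> list_all2 (\<lambda>v d. T \<chi> (v d)) vs ds)"
  using assms
proof (induction vs ds rule: list_induct2)
  case (Cons v vs d ds)
  then have "v d \<in> carrier R" by auto
  with Cons show ?case by simp
qed simp

lemma finite_listset_supp: "set vs \<subseteq> free_vecs R E \<Longrightarrow> finite (listset (map (supp R) vs))"
  by (rule finite_listset) (auto simp: free_vecs_def)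

lemma T_listset:
  assumes "\<chi> \<in> X" "list_all2 (\<lambda>v d. T \<chi> (v d)) vs ds"
  shows "ds \<in> listset (map (supp R) vs)"
proof -
  have "ds ! i \<in> supp R (vs ! i)" if "i < length vs" for i
    using assms that T_supp[OF assms(1), of "vs ! i" "ds ! i"] by (simp add: list_all2_conv_all_nth)
  then show ?thesis
    using list_all2_lengthD[OF assms(2)] by (simp add: in_listset_iff list_all2_conv_all_nth)
qed

text \<open>At \<chi> a vector becomes a set of basis elements and the lift of g becomes the image
  operation on sets: products turn into conjunctions, the sum into an existential quantifier.
  Restricting the sum to the supports loses nothing, since by \<open>T_listset\<close> a tuple that
  is true at \<chi> lies in them.\<close>

lemma lift_op_spec:
  fixes g :: "'e list \<Rightarrow> 'e"
  assumes "set vs \<subseteq> free_vecs R E"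
  shows "lift_op R g vs d \<in> carrier R"
    and "\<chi> \<in> X \<Longrightarrow> T \<chi> (lift_op R g vs d) \<longleftrightarrow> (\<exists>ds. list_all2 (\<lambda>v d. T \<chi> (v d)) vs ds \<and> g ds = d)"
proof -
  let ?L = "listset (map (supp R) vs)"
  let ?c = "\<lambda>ds. foldr (\<lambda>(v, d) r. v d \<otimes> r) (zip vs ds) \<one>"
  have fin: "finite ?L"
    using assms by (rule finite_listset_supp)
  have len: "length vs = length ds" if "ds \<in> ?L" for ds
    using that by (auto simp: in_listset_iff dest: list_all2_lengthD)
  have rng: "\<And>v. v \<in> set vs \<Longrightarrow> range v \<subseteq> carrier R"
    using assms by (auto simp: free_vecs_def)
  have u: "unit_vec R x y \<in> carrier R" for x y :: 'e
    by (simp add: unit_vec_def)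
  have c: "?c ds \<in> carrier R" if "ds \<in> ?L" for ds
    using lift_coeff[OF len rng] that by blast
  have cl: "(\<lambda>ds. ?c ds \<otimes> unit_vec R (g ds) d) \<in> ?L \<rightarrow> carrier R"
    using c u by auto
  then show "lift_op R g vs d \<in> carrier R"
    unfolding lift_op_def by (rule finsum_closed)
  assume \<chi>: "\<chi> \<in> X"
  have "T \<chi> (lift_op R g vs d) \<longleftrightarrow> (\<exists>ds\<in>?L. T \<chi> (?c ds \<otimes> unit_vec R (g ds) d))"
    unfolding lift_op_def by (rule T_finsum[OF \<chi> fin cl])
  also have "\<dots> \<longleftrightarrow> (\<exists>ds\<in>?L. list_all2 (\<lambda>v d. T \<chi> (v d)) vs ds \<and> g ds = d)"
    using lift_coeff[OF len rng] c u \<chi> by (intro bex_cong) auto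
  also have "\<dots> \<longleftrightarrow> (\<exists>ds. list_all2 (\<lambda>v d. T \<chi> (v d)) vs ds \<and> g ds = d)"
    using T_listset[OF \<chi>] by blast
  finally show "T \<chi> (lift_op R g vs d) \<longleftrightarrow> (\<exists>ds. list_all2 (\<lambda>v d. T \<chi> (v d)) vs ds \<and> g ds = d)" .
qed

lemma lift_op_free:
  assumes vs: "set vs \<subseteq> free_vecs R E"
    and g: "\<And>ds. length ds = length vs \<Longrightarrow> set ds \<subseteq> E \<Longrightarrow> g ds \<in> E'"
  shows "lift_op R g vs \<in> free_vecs R E'"
proof (rule free_vecsI[of _ "g ` listset (map (supp R) vs)"])
  show "lift_op R g vs d \<in> carrier R" for d
    by (rule lift_op_spec(1)[OF vs])
  show "finite (g ` listset (map (supp R) vs))"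
    using finite_listset_supp[OF vs] by simp
  show "g ` listset (map (supp R) vs) \<subseteq> E'"
  proof
    fix y assume "y \<in> g ` listset (map (supp R) vs)"
    then obtain ds where ds: "y = g ds" "list_all2 (\<in>) ds (map (supp R) vs)"
      by (auto simp: in_listset_iff)
    have "ds ! i \<in> E" if "i < length ds" for i
    proof -
      have "ds ! i \<in> supp R (vs ! i)" "vs ! i \<in> free_vecs R E"
        using ds(2) that vs by (auto simp: list_all2_conv_all_nth subset_iff)
      then show ?thesis using free_vecs_supp by blast
    qed
    then have "set ds \<subseteq> E"
      by (auto simp: in_set_conv_nth)
    with ds show "y \<in> E'"
      using g[of ds] list_all2_lengthD[OF ds(2)] by simp
  qed
  show "d \<in> g ` listset (map (supp R) vs)" if \<chi>: "\<chi> \<in> X" "T \<chi> (lift_op R g vs d)" for \<chi> d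
  proof -
    obtain ds where "list_all2 (\<lambda>v d. T \<chi> (v d)) vs ds" "g ds = d"
      using \<chi> lift_op_spec(2)[OF vs \<chi>(1)] by blast
    then show ?thesis
      using T_listset[OF \<chi>(1)] by blast
  qed
qed

lemma sm_free:
  assumes "s \<in> sm_symbols R" "length vs = sm_arity s" "set vs \<subseteq> free_vecs R E"
  shows "sm_interp R s vs \<in> free_vecs R E"
proof (cases s)
  case SAdd
  then obtain v w where vs: "vs = [v, w]" "v \<in> free_vecs R E" "w \<in> free_vecs R E"
    using assms by (auto simp: numeral_2_eq_2 length_Suc_conv)
  show ?thesis
    by (rule free_vecsI[of _ "supp R v \<union> supp R w"])
      (use SAdd vs free_vecs_supp[OF vs(2)] free_vecs_supp[OF vs(3)] T_supp[of _ v] T_supp[of _ w] in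
        \<open>auto simp: sm_interp_def free_vecs_closed[of _ E]\<close>)
next
  case SZero
  then show ?thesis by (simp add: sm_interp_def zero_vec_free)
next
  case (SScal r)
  then obtain v where vs: "vs = [v]" "v \<in> free_vecs R E" "r \<in> carrier R"
    using assms by (auto simp: length_Suc_conv sm_symbols_def)
  show ?thesis
    by (rule free_vecsI[of _ "supp R v"])
      (use SScal vs free_vecs_supp[OF vs(2)] T_supp[of _ v] in
        \<open>auto simp: sm_interp_def free_vecs_closed[of _ E]\<close>)
qed

text \<open>The kernel of the coordinatewise application of \<chi>. All operations on vectors
  respect it, and intersections of such kernels are the congruences used to bound \<theta>(v,
  c_i).\<close>

definition agree :: "'x \<Rightarrow> ('e \<Rightarrow> 'r) \<Rightarrow> ('e \<Rightarrow> 'r) \<Rightarrow> bool" where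
  "agree \<chi> v w \<longleftrightarrow> (\<forall>d. T \<chi> (v d) \<longleftrightarrow> T \<chi> (w d))"

lemma sm_agree:
  assumes "\<chi> \<in> X" "s \<in> sm_symbols R" "length vs = sm_arity s" "set vs \<subseteq> free_vecs R E"
    "set ws \<subseteq> free_vecs R E" "list_all2 (agree \<chi>) vs ws"
  shows "agree \<chi> (sm_interp R s vs) (sm_interp R s ws)"
proof (cases s)
  case SAdd
  then show ?thesis
    using assms
    by (auto simp: free_vecs_closed[of _ E] numeral_2_eq_2 length_Suc_conv list_all2_Cons1 sm_interp_def agree_def)
next
  case SZero
  then show ?thesis by (simp add: sm_interp_def agree_def)
next
  case (SScal r)
  then show ?thesis
    using assms
    by (auto simp: free_vecs_closed[of _ E] length_Suc_conv list_all2_Cons1 sm_interp_def agree_def sm_symbols_def)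
qed

lemma q_vec_agree:
  assumes "\<chi> \<in> X" "length vs = Suc (length cs)" "set vs \<subseteq> free_vecs R E"
    "set ws \<subseteq> free_vecs R E" "list_all2 (agree \<chi>) vs ws"
  shows "agree \<chi> (q_vec R cs vs) (q_vec R cs ws)"
proof -
  obtain v vs' where v: "vs = v # vs'" "length vs' = length cs"
    using assms(2) by (auto simp: length_Suc_conv)
  obtain w ws' where w: "ws = w # ws'" "agree \<chi> v w" "list_all2 (agree \<chi>) vs' ws'"
    using assms(5) v by (auto simp: list_all2_Cons1)
  have rng: "range u \<subseteq> carrier R" if "u \<in> set vs \<union> set ws" for u
    using that assms(3,4) free_vecs_closed[of u E] by auto
  have len: "length ws' = length cs"
    using w(3) v(2) by (simp add: list_all2_lengthD[symmetric])
  show ?thesis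
    unfolding agree_def v w using rng len v w
    by (auto simp: T_q_vec[OF assms(1)] agree_def list_all2_conv_all_nth)
qed

lemma lift_op_agree:
  assumes "\<chi> \<in> X" "set vs \<subseteq> free_vecs R E" "set ws \<subseteq> free_vecs R E" "list_all2 (agree \<chi>) vs ws"
  shows "agree \<chi> (lift_op R g vs) (lift_op R g ws)"
proof -
  have "list_all2 (\<lambda>v d. T \<chi> (v d)) vs ds \<longleftrightarrow> list_all2 (\<lambda>v d. T \<chi> (v d)) ws ds" for ds
    using assms(4) by (auto simp: list_all2_conv_all_nth agree_def)
  then show ?thesis
    using assms by (simp add: agree_def lift_op_spec(2))
qed

section \<open>Point vectors, that is, finitely supported partitions of unity\<close>

definition point_vecs :: "'e set \<Rightarrow> ('e \<Rightarrow> 'r) set" where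
  "point_vecs E = {v \<in> free_vecs R E. \<forall>\<chi>\<in>X. \<exists>!d. T \<chi> (v d)}"

definition pt :: "'x \<Rightarrow> ('e \<Rightarrow> 'r) \<Rightarrow> 'e" where
  "pt \<chi> v = (THE d. T \<chi> (v d))"

lemma point_vecs_free: "v \<in> point_vecs E \<Longrightarrow> v \<in> free_vecs R E"
  by (simp add: point_vecs_def)

lemma T_pt: "v \<in> point_vecs E \<Longrightarrow> \<chi> \<in> X \<Longrightarrow> T \<chi> (v d) \<longleftrightarrow> d = pt \<chi> v"
  unfolding point_vecs_def pt_def using theI'[of "\<lambda>d. T \<chi> (v d)"] by blast

lemma pt_mem: "v \<in> point_vecs E \<Longrightarrow> \<chi> \<in> X \<Longrightarrow> pt \<chi> v \<in> E"
  using T_pt[of v E \<chi> "pt \<chi> v"] T_supp[of \<chi> v "pt \<chi> v"] free_vecs_supp(1)[OF point_vecs_free, of v E]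
  by blast

lemma point_vecsI:
  assumes "v \<in> free_vecs R E" "\<And>\<chi> d. \<chi> \<in> X \<Longrightarrow> T \<chi> (v d) \<longleftrightarrow> d = p \<chi>"
  shows "v \<in> point_vecs E" and "\<chi> \<in> X \<Longrightarrow> pt \<chi> v = p \<chi>"
  using assms by (auto simp: point_vecs_def pt_def)

text \<open>This reduces equations between point vectors to equations between basis elements, one
  for each \<chi>.\<close>

lemma point_vecs_ext:
  assumes "v \<in> point_vecs E" "w \<in> point_vecs E'" "\<And>\<chi>. \<chi> \<in> X \<Longrightarrow> pt \<chi> v = pt \<chi> w"
  shows "v = w"
  using assms by (intro vec_ext[OF point_vecs_free point_vecs_free]) (auto simp: T_pt)

lemma unit_vec_point:
  assumes "d \<in> E"
  shows "unit_vec R d \<in> point_vecs E" and "\<chi> \<in> X \<Longrightarrow> pt \<chi> (unit_vec R d) = d"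
  using point_vecsI[OF unit_vec_free[OF assms], of "\<lambda>_. d"] by auto

text \<open>If every argument is a singleton at \<chi>, then \<open>map (pt \<chi>) vs\<close> is
  the only tuple that contributes, so the image under g is a singleton too.\<close>

lemma lift_op_point:
  assumes vs: "set vs \<subseteq> point_vecs E"
    and g: "\<And>ds. length ds = length vs \<Longrightarrow> set ds \<subseteq> E \<Longrightarrow> g ds \<in> E'"
  shows "lift_op R g vs \<in> point_vecs E'"
    and "\<chi> \<in> X \<Longrightarrow> pt \<chi> (lift_op R g vs) = g (map (pt \<chi>) vs)"
proof -
  have free: "set vs \<subseteq> free_vecs R E"
    using vs point_vecs_free by blast
  have T: "T \<chi> (lift_op R g vs d) \<longleftrightarrow> d = g (map (pt \<chi>) vs)" if \<chi>: "\<chi> \<in> X" for \<chi> d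
  proof -
    have "list_all2 (\<lambda>v d. T \<chi> (v d)) vs ds \<longleftrightarrow> ds = map (pt \<chi>) vs" for ds
    proof -
      have "T \<chi> ((vs ! i) d) \<longleftrightarrow> d = pt \<chi> (vs ! i)" if "i < length vs" for i d
        using T_pt[OF subsetD[OF vs nth_mem[OF that]] \<chi>] .
      then show ?thesis
        by (auto simp: list_all2_conv_all_nth intro: nth_equalityI)
    qed
    then show ?thesis
      using lift_op_spec(2)[OF free \<chi>] by auto
  qed
  have "lift_op R g vs \<in> free_vecs R E'"
    using free g by (rule lift_op_free)
  from point_vecsI[OF this T] show "lift_op R g vs \<in> point_vecs E'"
    "\<chi> \<in> X \<Longrightarrow> pt \<chi> (lift_op R g vs) = g (map (pt \<chi>) vs)" by auto
qed

text \<open>The linear extension of \<open>w\<close>: the vector \<open>w a\<close> is substituted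
  for each basis element \<open>a\<close> of the formal sum \<open>v\<close>.\<close>

definition bind :: "('d \<Rightarrow> 'r) \<Rightarrow> ('d \<Rightarrow> 'e \<Rightarrow> 'r) \<Rightarrow> 'e \<Rightarrow> 'r" where
  "bind v w = (\<lambda>d. \<Oplus>a \<in> supp R v. v a \<otimes> w a d)"

text \<open>At \<chi> only the summand indexed by the point of v survives, and the point of that
  summand is taken at the same \<chi>.\<close>

lemma bind_point:
  assumes v: "v \<in> point_vecs D" and w: "\<And>a. a \<in> D \<Longrightarrow> w a \<in> point_vecs E"
  shows "bind v w \<in> point_vecs E" and "\<chi> \<in> X \<Longrightarrow> pt \<chi> (bind v w) = pt \<chi> (w (pt \<chi> v))"
proof -
  have fin: "finite (supp R v)" and sub: "supp R v \<subseteq> D"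
    using free_vecs_supp[OF point_vecs_free[OF v]] by auto
  have wa: "w a \<in> point_vecs E" if "a \<in> supp R v" for a
    using w sub that by blast
  have vc: "v a \<in> carrier R" for a
    using free_vecs_closed[OF point_vecs_free[OF v]] .
  have wc: "w a d \<in> carrier R" if "a \<in> supp R v" for a d
    using free_vecs_closed[OF point_vecs_free[OF wa[OF that]]] .
  have cl: "(\<lambda>a. v a \<otimes> w a d) \<in> supp R v \<rightarrow> carrier R" for d
    using vc wc by auto
  have T: "T \<chi> (bind v w d) \<longleftrightarrow> d = pt \<chi> (w (pt \<chi> v))" if \<chi>: "\<chi> \<in> X" for \<chi> d
  proof -
    have "T \<chi> (bind v w d) \<longleftrightarrow> (\<exists>a\<in>supp R v. T \<chi> (v a \<otimes> w a d))"
      unfolding bind_def by (rule T_finsum[OF \<chi> fin cl])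
    also have "\<dots> \<longleftrightarrow> (\<exists>a\<in>supp R v. a = pt \<chi> v \<and> d = pt \<chi> (w a))"
      using vc wc T_pt[OF v \<chi>] T_pt[OF wa \<chi>] \<chi> by (intro bex_cong) auto
    also have "\<dots> \<longleftrightarrow> d = pt \<chi> (w (pt \<chi> v))"
      using T_supp[OF \<chi>, of v] T_pt[OF v \<chi>] by auto
    finally show ?thesis .
  qed
  have "bind v w \<in> free_vecs R E"
  proof (rule free_vecsI[of _ "\<Union>a\<in>supp R v. supp R (w a)"])
    show "bind v w d \<in> carrier R" for d
      unfolding bind_def by (rule finsum_closed[OF cl])
    show "finite (\<Union>a\<in>supp R v. supp R (w a))"
      using fin free_vecs_supp(2)[OF point_vecs_free[OF wa]] by blast
    show "(\<Union>a\<in>supp R v. supp R (w a)) \<subseteq> E"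
      using free_vecs_supp(1)[OF point_vecs_free[OF wa]] by blast
    show "d \<in> (\<Union>a\<in>supp R v. supp R (w a))" if \<chi>: "\<chi> \<in> X" and d: "T \<chi> (bind v w d)" for \<chi> d
    proof -
      have p: "pt \<chi> v \<in> supp R v"
        using T_supp[OF \<chi>, of v] T_pt[OF v \<chi>] by blast
      have "T \<chi> (w (pt \<chi> v) d)"
        using T[OF \<chi>] d T_pt[OF wa[OF p] \<chi>] by simp
      with p show ?thesis
        using T_supp[OF \<chi>, of "w (pt \<chi> v)" d] by blast
    qed
  qed
  from point_vecsI[OF this T] show "bind v w \<in> point_vecs E"
    "\<chi> \<in> X \<Longrightarrow> pt \<chi> (bind v w) = pt \<chi> (w (pt \<chi> v))" by auto
qed

text \<open>The central elements of an algebra of vectors are the vectors whose image under every \<open>\<chi>\<close> is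
  a basis vector. If \<open>v\<close> is such a vector, then \<open>v\<close> and \<open>c\<^sub>i\<close> are identified by the congruence of
  agreeing at all \<open>\<chi>\<close> with \<open>T \<chi> (v c\<^sub>i)\<close>.\<close>

lemma n_central_vec_iff:
  fixes E :: "'e set"
  assumes M: "ua_algebra S M" and carr: "carrier M = free_vecs R E"
    and ag: "\<And>\<chi> f xs ys. \<chi> \<in> X \<Longrightarrow> f \<in> symbols S \<Longrightarrow> xs \<in> args S M f \<Longrightarrow> ys \<in> args S M f \<Longrightarrow>
        list_all2 (agree \<chi>) xs ys \<Longrightarrow> agree \<chi> (interp M f xs) (interp M f ys)"
    and q: "q \<in> symbols S" "arity S q = Suc (length cs)" "\<And>vs. interp M q vs = q_vec R cs vs"
    and es: "length es = length cs" "\<And>i. i < length cs \<Longrightarrow> es ! i \<in> symbols S \<and> arity S (es ! i) = 0"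
      "\<And>i. i < length cs \<Longrightarrow> interp M (es ! i) [] = unit_vec R (cs ! i)"
    and cs: "cs \<noteq> []" "distinct cs" "set cs \<subseteq> E"
  shows "n_central S M q es v \<longleftrightarrow> v \<in> point_vecs E \<and> supp R v \<subseteq> set cs"
proof -
  have rng: "range v \<subseteq> carrier R" if "v \<in> free_vecs R E" for v
    using that by (auto simp: free_vecs_def)
  have unit: "unit_vec R (cs ! i) \<in> free_vecs R E" if "i < length cs" for i
    using that cs by (intro unit_vec_free) (auto simp: subset_iff)
  have dim: "has_dim S M q es"
    unfolding has_dim_def
  proof (intro conjI allI impI ballI)
    fix i bs assume i: "i < length es" and bs: "length bs = length es \<and> set bs \<subseteq> carrier M"
    have "q_vec R cs (unit_vec R (cs ! i) # bs) = bs ! i"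
    proof (rule vec_ext)
      show "q_vec R cs (unit_vec R (cs ! i) # bs) \<in> free_vecs R E"
        using i bs es carr unit by (intro q_vec_free) auto
      show "bs ! i \<in> free_vecs R E"
        using i bs carr by (auto simp: subset_iff)
      fix \<chi> d assume \<chi>: "\<chi> \<in> X"
      have "T \<chi> (q_vec R cs (unit_vec R (cs ! i) # bs) d) \<longleftrightarrow>
          (\<exists>j < length cs. T \<chi> (unit_vec R (cs ! i) (cs ! j)) \<and> T \<chi> ((bs ! j) d))"
        using i bs es carr by (intro T_q_vec \<chi> rng unit) auto
      then show "T \<chi> (q_vec R cs (unit_vec R (cs ! i) # bs) d) \<longleftrightarrow> T \<chi> ((bs ! i) d)"
        using \<chi> i es cs by (auto simp: nth_eq_iff_index_eq)
    qed
    then show "interp M q (interp M (es ! i) [] # bs) = bs ! i"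
      using i es q by simp
  qed (use q es in \<open>auto simp: in_set_conv_nth\<close>)
  show ?thesis
  proof (cases "v \<in> free_vecs R E")
    case False
    then show ?thesis
      using n_central_iff[OF M] carr by (auto simp: point_vecs_def)
  next
    case True
    note v = True
    define t where "t i = theta S M v (unit_vec R (cs ! i))" for i
    have t: "congruence S M (t i)" if "i < length cs" for i
      unfolding t_def using v unit[OF that] carr by (intro congruence_theta M) auto
    have tq: "(q_vec R cs (v # bs), bs ! i) \<in> t i"
      if "i < length cs" "length bs = length cs" "set bs \<subseteq> free_vecs R E" for i bs
      using theta_q[OF M dim, of v i bs] that es q v carr by (simp add: t_def)
    have tr: "(x, z) \<in> t i" if "i < length cs" "(x, y) \<in> t i" "(y, z) \<in> t i" for i x y z
      by (rule congruence_trans[OF t[OF that(1)] that(2,3)])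
    have sy: "(y, x) \<in> t i" if "i < length cs" "(x, y) \<in> t i" for i x y
      by (rule congruence_sym[OF t[OF that(1)] that(2)])
    have central: "n_central S M q es v \<longleftrightarrow>
        (\<forall>x\<in>free_vecs R E. \<forall>y\<in>free_vecs R E. (\<forall>i<length cs. (x, y) \<in> t i) \<longrightarrow> x = y)"
      using n_central_iff[OF M] dim v carr es by (simp add: separating_def t_def)
    show ?thesis
    proof
      assume "n_central S M q es v"
      then have sep: "x = y" if "x \<in> free_vecs R E" "y \<in> free_vecs R E"
        "\<And>i. i < length cs \<Longrightarrow> (x, y) \<in> t i" for x y
        using that central by blast
      define us where "us = map (unit_vec R) cs"
      have us: "length us = length cs" "set us \<subseteq> free_vecs R E"
        using cs by (auto simp: us_def intro!: unit_vec_free)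
      \<comment> \<open>Modulo \<theta>(v, c_i) both sides become c_i. The resulting expansion of v
        in the basis elements c_i confines its support to them.\<close>
      have vq: "q_vec R cs (v # us) = v"
      proof (rule sep)
        fix i assume i: "i < length cs"
        have "(v, us ! i) \<in> t i"
          using i theta_mem by (simp add: us_def t_def)
        then show "(q_vec R cs (v # us), v) \<in> t i"
          using tr[OF i tq[OF i us] sy[OF i]] by blast
      qed (use v us q_vec_free in auto)
      have in_cs: "\<exists>i < length cs. d = cs ! i" if \<chi>: "\<chi> \<in> X" and d: "T \<chi> (v d)" for \<chi> d
      proof -
        have "T \<chi> (q_vec R cs (v # us) d) \<longleftrightarrow>
            (\<exists>i < length cs. T \<chi> (v (cs ! i)) \<and> T \<chi> ((us ! i) d))"
          using us by (intro T_q_vec[OF \<chi> rng[OF v]] rng) auto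
        with d have "\<exists>i < length cs. T \<chi> (v (cs ! i)) \<and> T \<chi> ((us ! i) d)"
          unfolding vq by blast
        with \<chi> show ?thesis by (auto simp: us_def)
      qed
      have supp: "supp R v \<subseteq> set cs"
      proof -
        have "v d = \<zero>" if "d \<notin> set cs" for d
        proof (rule T_ext)
          show "T \<chi> (v d) \<longleftrightarrow> T \<chi> \<zero>" if "\<chi> \<in> X" for \<chi>
            using in_cs[OF that, of d] \<open>d \<notin> set cs\<close> that by auto
        qed (use free_vecs_closed[OF v] in auto)
        then show ?thesis by (auto simp: supp_def)
      qed
      have len: "0 < length cs" using cs by simp
      let ?u = "unit_vec R (cs ! 0)"
      \<comment> \<open>The coefficients join to 1: q(v, u, ..., u) = u holds modulo every
        \<theta>(v, c_i), and the left side can be true at c_1 only where some coefficient of v is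
        true.\<close>
      have ex: "\<exists>d. T \<chi> (v d)" if \<chi>: "\<chi> \<in> X" for \<chi>
      proof -
        have rep: "length (replicate (length cs) ?u) = length cs"
          "set (replicate (length cs) ?u) \<subseteq> free_vecs R E"
          using unit[OF len] by auto
        have "q_vec R cs (v # replicate (length cs) ?u) = ?u"
        proof (rule sep)
          show "(q_vec R cs (v # replicate (length cs) ?u), ?u) \<in> t i" if "i < length cs" for i
            using tq[OF that rep] that by simp
        qed (use q_vec_free[OF v rep] unit[OF len] in auto)
        then have "T \<chi> (q_vec R cs (v # replicate (length cs) ?u) (cs ! 0))"
          using \<chi> by simp
        moreover have "range w \<subseteq> carrier R" if "w \<in> set (replicate (length cs) ?u)" for w
          using rep(2) that by (intro rng) blast
        ultimately show ?thesis
          using T_q_vec[OF \<chi> rng[OF v] rep(1)] by blast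
      qed
      have uniq: "d = d'" if \<chi>: "\<chi> \<in> X" and d: "T \<chi> (v d)" "T \<chi> (v d')" for \<chi> d d'
      proof (rule ccontr)
        assume "d \<noteq> d'"
        obtain i j where ij: "i < length cs" "d = cs ! i" "j < length cs" "d' = cs ! j"
          using in_cs[OF \<chi>] d by blast
        with \<open>d \<noteq> d'\<close> have "i \<noteq> j" by auto
        \<comment> \<open>The coefficients are pairwise disjoint: the entry of z at
          \<open>cs ! 0\<close> is the product of v(c_i) and v(c_j). Modulo \<theta>(v, c_j) the
          vector z becomes w and w becomes 0, because j differs from i; modulo the other congruences
          z becomes 0 at once. Hence z = 0.\<close>
        define zs where "zs = replicate (length cs) (\<lambda>d::'e. \<zero>)"
        define w where "w = q_vec R cs (v # zs[i := ?u])"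
        define z where "z = q_vec R cs (v # zs[j := w])"
        have upd: "set (zs[k := x]) \<subseteq> free_vecs R E" if "x \<in> free_vecs R E" for k x
        proof -
          have "set zs \<subseteq> free_vecs R E"
            using zero_vec_free[of E] by (auto simp: zs_def)
          then show ?thesis
            using set_update_subset_insert[of zs k x] that by blast
        qed
        have lz: "length (zs[k := x]) = length cs" for k x
          by (simp add: zs_def)
        have w: "w \<in> free_vecs R E"
          unfolding w_def using v upd unit[OF len] lz by (intro q_vec_free)
        have z: "z \<in> free_vecs R E"
          unfolding z_def using v upd w lz by (intro q_vec_free)
        have "z = (\<lambda>d. \<zero>)"
        proof (rule sep[OF z zero_vec_free])
          fix k assume k: "k < length cs"
          have zk: "(z, zs[j := w] ! k) \<in> t k"
            unfolding z_def using tq[OF k lz upd[OF w]] .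
          show "(z, \<lambda>d. \<zero>) \<in> t k"
          proof (cases "k = j")
            case True
            have "(w, zs[i := ?u] ! k) \<in> t k"
              unfolding w_def using tq[OF k lz upd[OF unit[OF len]]] .
            then show ?thesis
              using zk True \<open>i \<noteq> j\<close> k tr[OF k] by (auto simp: zs_def)
          next
            case False
            with zk k show ?thesis by (simp add: zs_def)
          qed
        qed
        moreover have "T \<chi> (z (cs ! 0))"
        proof -
          have Tq: "T \<chi> (q_vec R cs (v # zs[k := x]) d) \<longleftrightarrow>
              (\<exists>i < length cs. T \<chi> (v (cs ! i)) \<and> T \<chi> ((zs[k := x] ! i) d))"
            if "x \<in> free_vecs R E" for k x d
            by (rule T_q_vec[OF \<chi> rng[OF v] lz rng[OF subsetD[OF upd[OF that]]]])
          have "T \<chi> (w (cs ! 0))"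
            unfolding w_def Tq[OF unit[OF len]] using ij d \<chi> by (intro exI[of _ i]) (simp add: zs_def)
          then show ?thesis
            unfolding z_def Tq[OF w] using ij d by (intro exI[of _ j]) (simp add: zs_def)
        qed
        ultimately show False using \<chi> by simp
      qed
      show "v \<in> point_vecs E \<and> supp R v \<subseteq> set cs"
        using v supp ex uniq by (auto simp: point_vecs_def)
    next
      assume v': "v \<in> point_vecs E \<and> supp R v \<subseteq> set cs"
      show "n_central S M q es v"
        unfolding central
      proof (intro ballI impI)
        fix x y assume xy: "x \<in> free_vecs R E" "y \<in> free_vecs R E" "\<forall>i<length cs. (x, y) \<in> t i"
        define s where "s i = {(x, y). x \<in> free_vecs R E \<and> y \<in> free_vecs R E \<and>
          (\<forall>\<chi>\<in>X. T \<chi> (v (cs ! i)) \<longrightarrow> agree \<chi> x y)}" for i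
        have s: "congruence S M (s i)" for i
        proof (rule congruenceI)
          show "equiv (carrier M) (s i)"
            by (intro equivI refl_onI symI transI) (auto simp: s_def carr agree_def)
          fix f xs ys
          assume f: "f \<in> symbols S" "xs \<in> args S M f" and l: "list_all2 (\<lambda>x y. (x, y) \<in> s i) xs ys"
          have ys: "ys \<in> args S M f"
            using l f(2) by (auto simp: args_def list_all2_conv_all_nth s_def carr in_set_conv_nth)
          have "list_all2 (agree \<chi>) xs ys" if "\<chi> \<in> X" "T \<chi> (v (cs ! i))" for \<chi>
            using l by (rule list_all2_mono) (use that in \<open>auto simp: s_def\<close>)
          then show "(interp M f xs, interp M f ys) \<in> s i"
            using ag[OF _ f ys] M f ys unfolding s_def by (auto simp: ua_algebra_def carr)
        qed
        have "t i \<subseteq> s i" if i: "i < length cs" for i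
          unfolding t_def
        proof (rule theta_least[OF s])
          show "(v, unit_vec R (cs ! i)) \<in> s i"
            using v unit[OF i] T_pt[OF conjunct1[OF v']] by (auto simp: s_def agree_def)
        qed
        then have sxy: "(x, y) \<in> s i" if "i < length cs" for i
          using xy(3) that by blast
        show "x = y"
        proof (rule vec_ext[OF xy(1,2)])
          fix \<chi> d assume \<chi>: "\<chi> \<in> X"
          have T: "T \<chi> (v (pt \<chi> v))"
            using T_pt[OF conjunct1[OF v'] \<chi>] by simp
          \<comment> \<open>The support condition makes the point of v at \<chi> one of the c_i, and
            membership in that \<open>s i\<close> yields agreement at \<chi>.\<close>
          then obtain i where "i < length cs" "pt \<chi> v = cs ! i"
            using T_supp[of \<chi> v "pt \<chi> v", OF \<chi> T] v' by (metis in_set_conv_nth subsetD)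
          then show "T \<chi> (x d) \<longleftrightarrow> T \<chi> (y d)"
            using sxy[of i] \<chi> T by (auto simp: s_def agree_def)
        qed
      qed
    qed
  qed
qed

section \<open>The carriers of the two algebras of central vectors\<close>

lemma carrier_Ce_pow:
  assumes "n \<ge> 1"
  shows "carrier (Ce_pow R n) = point_vecs {1..n}"
proof -
  let ?S = "pow_sig R n" and ?M = "pow_alg R n"
  have carr: "carrier ?M = free_vecs R {1..n}"
    by (simp add: pow_alg_def)
  have len: "length [1..<Suc n] = n" by simp
  have alg: "ua_algebra ?S ?M"
  proof -
    have "interp ?M f xs \<in> carrier ?M" if f: "f \<in> symbols ?S" "xs \<in> args ?S ?M f" for f xs
    proof (cases f)
      case (Inl s)
      then show ?thesis
        using f sm_free[of s xs] by (auto simp: pow_sig_def pow_alg_def args_def)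
    next
      case (Inr s)
      show ?thesis
      proof (cases s)
        case Qop
        then obtain v ws where "xs = v # ws" "length ws = n" "set xs \<subseteq> free_vecs R {1..n}"
          using Inr f by (cases xs) (auto simp: pow_sig_def pow_alg_def args_def nu_def)
        then show ?thesis
          using Inr Qop q_vec_free[of v "{1..n}" ws "[1..<Suc n]"] by (simp add: pow_alg_def del: upt_Suc)
      next
        case (Ec i)
        then show ?thesis
          using Inr f unit_vec_free[of i "{1..n}"] by (auto simp: pow_sig_def pow_alg_def nu_def)
      qed
    qed
    then show ?thesis
      using zero_vec_free by (auto simp: ua_algebra_def carr)
  qed
  have ag: "agree \<chi> (interp ?M f xs) (interp ?M f ys)"
    if \<chi>: "\<chi> \<in> X" and f: "f \<in> symbols ?S" "xs \<in> args ?S ?M f" "ys \<in> args ?S ?M f"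
      and l: "list_all2 (agree \<chi>) xs ys" for \<chi> f xs ys
  proof (cases f)
    case (Inl s)
    then show ?thesis
      using f sm_agree[OF \<chi> _ _ _ _ l, of s "{1..n}"]
      by (auto simp: pow_sig_def pow_alg_def args_def)
  next
    case (Inr s)
    then show ?thesis
      using f q_vec_agree[OF \<chi> _ _ _ l, of "[1..<Suc n]" "{1..n}"]
      by (cases s) (auto simp: pow_sig_def pow_alg_def args_def nu_def agree_def simp del: upt_Suc)
  qed
  have "n_central ?S ?M (Inr Qop) (map Inr (nu_consts n)) v \<longleftrightarrow>
      v \<in> point_vecs {1..n} \<and> supp R v \<subseteq> set [1..<Suc n]" for v
    using assms
    by (intro n_central_vec_iff[OF alg carr ag])
      (auto simp: pow_sig_def pow_alg_def nu_def simp del: upt_Suc)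
  \<comment> \<open>The enumeration exhausts the basis, so the support condition is
    automatic.\<close>
  moreover have "supp R v \<subseteq> set [1..<Suc n]" if "v \<in> point_vecs {1..n}" for v
    using free_vecs_supp(1)[OF point_vecs_free[OF that]] by (auto simp del: upt_Suc)
  ultimately show ?thesis
    by (auto simp: Ce_pow_def Ce_def simp del: upt_Suc)
qed

lemma carrier_semiring_power:
  fixes E :: "('f, 'e) ualg"
  assumes E: "ua_algebra S E"
  shows "carrier (semiring_power S E R) = point_vecs (carrier E)"
proof -
  let ?S = "V_sig S E R" and ?M = "V_alg E R"
  have carr: "carrier ?M = free_vecs R (carrier E)"
    by (simp add: V_alg_def)
  have alg: "ua_algebra ?S ?M"
  proof -
    have "interp ?M f xs \<in> carrier ?M" if f: "f \<in> symbols ?S" "xs \<in> args ?S ?M f" for f xs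
    proof (cases f)
      case (VSm s)
      then show ?thesis
        using f sm_free[of s xs] by (auto simp: V_sig_def V_alg_def args_def)
    next
      case (VLift g)
      then have "g \<in> symbols S" "length xs = arity S g" "set xs \<subseteq> free_vecs R (carrier E)"
        using f by (auto simp: V_sig_def V_alg_def args_def)
      then have "lift_op R (interp E g) xs \<in> free_vecs R (carrier E)"
        using E by (intro lift_op_free) (auto simp: ua_algebra_def args_def)
      then show ?thesis
        using VLift by (simp add: V_alg_def)
    next
      case (VQ cs)
      then obtain v ws where "xs = v # ws" "length ws = length cs" "set xs \<subseteq> free_vecs R (carrier E)"
        using f by (cases xs) (auto simp: V_sig_def V_alg_def args_def)
      then show ?thesis
        using VQ q_vec_free[of v "carrier E" ws cs] by (simp add: V_alg_def)
    next
      case (VConst d)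
      then show ?thesis
        using f unit_vec_free[of d "carrier E"] by (auto simp: V_sig_def V_alg_def)
    qed
    then show ?thesis
      using zero_vec_free by (auto simp: ua_algebra_def carr)
  qed
  have ag: "agree \<chi> (interp ?M f xs) (interp ?M f ys)"
    if \<chi>: "\<chi> \<in> X" and f: "f \<in> symbols ?S" "xs \<in> args ?S ?M f" "ys \<in> args ?S ?M f"
      and l: "list_all2 (agree \<chi>) xs ys" for \<chi> f xs ys
  proof (cases f)
    case (VSm s)
    then show ?thesis
      using f sm_agree[OF \<chi> _ _ _ _ l, of s "carrier E"] by (auto simp: V_sig_def V_alg_def args_def)
  next
    case (VLift g)
    then show ?thesis
      using f lift_op_agree[OF \<chi> _ _ l, of "carrier E"] by (auto simp: V_alg_def args_def)
  next
    case (VQ cs)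
    then show ?thesis
      using f q_vec_agree[OF \<chi> _ _ _ l, of cs "carrier E"] by (auto simp: V_sig_def V_alg_def args_def)
  next
    case (VConst d)
    then show ?thesis by (simp add: V_alg_def agree_def)
  qed
  have iff: "n_central ?S ?M (VQ cs) (map VConst cs) v \<longleftrightarrow>
      v \<in> point_vecs (carrier E) \<and> supp R v \<subseteq> set cs" if "cs \<in> enums (carrier E)" for v cs
    using that
    by (intro n_central_vec_iff[OF alg carr ag]) (auto simp: V_sig_def V_alg_def enums_def subset_iff)
  have "finitely_central S E R v \<longleftrightarrow> v \<in> point_vecs (carrier E)" for v
  proof
    assume "finitely_central S E R v"
    then show "v \<in> point_vecs (carrier E)"
      using iff by (auto simp: finitely_central_def)
  next
    assume v: "v \<in> point_vecs (carrier E)"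
    \<comment> \<open>An enumeration of the support serves as I. Adding \<open>d\<close> keeps it
      nonempty, since the support is empty when X is.\<close>
    obtain d where d: "d \<in> carrier E"
      using E by (auto simp: ua_algebra_def)
    have "finite (insert d (supp R v))"
      using free_vecs_supp(2)[OF point_vecs_free[OF v]] by simp
    then obtain cs where cs: "set cs = insert d (supp R v)" "distinct cs"
      using finite_distinct_list by blast
    then have "cs \<in> enums (carrier E)"
      using d free_vecs_supp(1)[OF point_vecs_free[OF v]] by (auto simp: enums_def)
    then show "finitely_central S E R v"
      using iff v cs by (auto simp: finitely_central_def)
  qed
  then show ?thesis
    by (simp add: semiring_power_def)
qed

lemma ua_algebra_semiring_power:
  assumes E: "ua_algebra S E"
  shows "ua_algebra S (semiring_power S E R)"
proof -
  obtain d where "d \<in> carrier E"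
    using E by (auto simp: ua_algebra_def)
  then have "unit_vec R d \<in> point_vecs (carrier E)"
    by (rule unit_vec_point)
  moreover have "lift_op R (interp E g) vs \<in> point_vecs (carrier E)"
    if "g \<in> symbols S" "length vs = arity S g" "set vs \<subseteq> point_vecs (carrier E)" for g vs
    using that E by (intro lift_op_point(1)) (auto simp: ua_algebra_def args_def)
  ultimately show ?thesis
    using carrier_semiring_power[OF E]
    by (auto simp: ua_algebra_def args_def semiring_power_def)
qed

lemma pt_semiring_power:
  assumes "ua_algebra S E" "g \<in> symbols S" "vs \<in> args S (semiring_power S E R) g" "\<chi> \<in> X"
  shows "pt \<chi> (interp (semiring_power S E R) g vs) = interp E g (map (pt \<chi>) vs)"
  using assms carrier_semiring_power[OF assms(1)]
  by (auto intro!: lift_op_point(2) simp: semiring_power_def args_def ua_algebra_def)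

end

section \<open>The isomorphisms and the retraction\<close>

lemma ua_algebra_n_alg: "n \<ge> 1 \<Longrightarrow> ua_algebra (nu n) (n_alg n)"
proof -
  assume n: "n \<ge> 1"
  have "interp (n_alg n) f xs \<in> {1..n}" if f: "f \<in> symbols (nu n)" "xs \<in> args (nu n) (n_alg n) f" for f xs
  proof (cases f)
    case Qop
    then have xs: "length xs = Suc n" "set xs \<subseteq> {1..n}"
      using f by (auto simp: args_def nu_def n_alg_def)
    then have "hd xs \<in> {1..n}"
      by (cases xs) auto
    then have "xs ! hd xs \<in> set xs"
      using xs by (intro nth_mem) auto
    with xs Qop show ?thesis by (auto simp: n_alg_def)
  qed (use f in \<open>auto simp: n_alg_def nu_def\<close>)
  with n show ?thesis
    by (auto simp: ua_algebra_def n_alg_def)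
qed

context pure_bla
begin

section \<open>Evaluation of the operations of A under homomorphisms to n\<close>

lemma \<eta>_mem: "\<eta> \<in> H \<Longrightarrow> a \<in> carrier A \<Longrightarrow> \<eta> a \<in> {1..n}"
  by (auto simp: H_def ua_hom_def n_alg_def)

lemma \<eta>_e:
  assumes "\<eta> \<in> H" "i \<in> {1..n}"
  shows "\<eta> (e i) = i"
proof -
  have "Ec i \<in> symbols (nu n)" "[] \<in> args (nu n) A (Ec i)"
    using assms by (auto simp: nu_def args_def)
  then have "\<eta> (e i) = interp (n_alg n) (Ec i) (map \<eta> [])"
    using assms unfolding H_def ua_hom_def by blast
  then show ?thesis by (simp add: n_alg_def)
qed

lemma \<eta>_q:
  assumes "\<eta> \<in> H" "length bs = n" "set bs \<subseteq> carrier A" "c \<in> carrier A"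
  shows "\<eta> (q (c # bs)) = \<eta> (bs ! (\<eta> c - 1))"
proof -
  have "Qop \<in> symbols (nu n)" "c # bs \<in> args (nu n) A Qop"
    using assms by (auto simp: nu_def args_def)
  then have "\<eta> (q (c # bs)) = interp (n_alg n) Qop (map \<eta> (c # bs))"
    using assms(1) unfolding H_def ua_hom_def by blast
  then show ?thesis
    using \<eta>_mem[OF assms(1,4)] assms(2) by (auto simp: n_alg_def nth_Cons')
qed

lemma A_ext: "x \<in> carrier A \<Longrightarrow> y \<in> carrier A \<Longrightarrow> (\<And>\<eta>. \<eta> \<in> H \<Longrightarrow> \<eta> x = \<eta> y) \<Longrightarrow> x = y"
  using H_separate by blast

lemma p_args:
  assumes "y \<in> carrier A" "z \<in> carrier A"
  shows "length ([y, z] @ map e [3..<Suc n]) = n" "set ([y, z] @ map e [3..<Suc n]) \<subseteq> carrier A"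
  using assms n2 e_closed by (auto simp del: upt_Suc)

lemma p_closed:
  assumes "x \<in> carrier A" "y \<in> carrier A" "z \<in> carrier A"
  shows "p_op n A x y z \<in> carrier A"
proof -
  have "q (x # [y, z] @ map e [3..<Suc n]) \<in> carrier A"
    using p_args[OF assms(2,3)] assms(1) by (intro q_closed) (auto simp del: upt_Suc)
  then show ?thesis by (simp add: p_op_def del: upt_Suc)
qed

text \<open>If \<eta> x = i with i > 2, the selected argument is the constant e_i, so the value of x
  itself is returned.\<close>

lemma \<eta>_p:
  assumes \<eta>: "\<eta> \<in> H" and xyz: "x \<in> carrier A" "y \<in> carrier A" "z \<in> carrier A"
  shows "\<eta> (p_op n A x y z) = (if \<eta> x = 1 then \<eta> y else if \<eta> x = 2 then \<eta> z else \<eta> x)"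
proof -
  have x: "\<eta> x \<in> {1..n}"
    using \<eta> xyz \<eta>_mem by blast
  have "\<eta> (p_op n A x y z) = \<eta> (([y, z] @ map e [3..<Suc n]) ! (\<eta> x - 1))"
    using \<eta>_q[OF \<eta> p_args[OF xyz(2,3)] xyz(1)] by (simp add: p_op_def del: upt_Suc)
  also have "([y, z] @ map e [3..<Suc n]) ! (\<eta> x - 1) =
      (if \<eta> x = 1 then y else if \<eta> x = 2 then z else e (\<eta> x))"
    using x by (auto simp: nth_Cons' nth_append simp del: upt_Suc)
  finally show ?thesis
    using \<eta>_e[OF \<eta> x] by simp
qed

section \<open>The Boolean semiring of A as a separated semiring\<close>

abbreviation B :: "'a ring" where "B \<equiv> B_semiring n A"

lemma B_iff: "x \<in> carrier B \<longleftrightarrow> x \<in> carrier A \<and> (\<forall>\<eta>\<in>H. \<eta> x = 1 \<or> \<eta> x = 2)"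
proof
  assume "x \<in> carrier B"
  then have x: "x \<in> carrier A" and p: "\<And>y. y \<in> carrier A \<Longrightarrow> p_op n A x y y = y"
    by (auto simp: B_semiring_def)
  have e1: "e 1 \<in> carrier A" using e_closed n2 by simp
  have "\<eta> x = 1 \<or> \<eta> x = 2" if \<eta>: "\<eta> \<in> H" for \<eta>
  proof -
    \<comment> \<open>A value of x above 2 would be returned unchanged here and could not equal
      1.\<close>
    have "\<eta> (p_op n A x (e 1) (e 1)) = 1"
      unfolding p[OF e1] using \<eta>_e[OF \<eta>, of 1] n2 by simp
    then show ?thesis
      unfolding \<eta>_p[OF \<eta> x e1 e1] by presburger
  qed
  with x show "x \<in> carrier A \<and> (\<forall>\<eta>\<in>H. \<eta> x = 1 \<or> \<eta> x = 2)" by blast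
next
  assume x: "x \<in> carrier A \<and> (\<forall>\<eta>\<in>H. \<eta> x = 1 \<or> \<eta> x = 2)"
  have "p_op n A x y y = y" if "y \<in> carrier A" for y
    using x that by (intro A_ext p_closed) (auto simp: \<eta>_p)
  with x show "x \<in> carrier B" by (simp add: B_semiring_def)
qed

lemma e12: "e 1 \<in> carrier A" "e 2 \<in> carrier A"
  using e_closed n2 by auto

lemma \<eta>_e12: "\<eta> \<in> H \<Longrightarrow> \<eta> (e 1) = 1" "\<eta> \<in> H \<Longrightarrow> \<eta> (e 2) = 2"
  using \<eta>_e n2 by auto

lemma B_ops: "\<zero>\<^bsub>B\<^esub> = e 1" "\<one>\<^bsub>B\<^esub> = e 2"
  "x \<oplus>\<^bsub>B\<^esub> y = p_op n A x y (e 2)" "x \<otimes>\<^bsub>B\<^esub> y = p_op n A x (e 1) y"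
  by (simp_all add: B_semiring_def)

text \<open>Truth means value 2 because the one of B is e_2 and its zero is e_1. On the values 1 and
  2 the formula \<open>\<eta>_p\<close> turns sum and product into disjunction and conjunction;
  extensionality is the separation of points by H.\<close>

sublocale separated_semiring B H "\<lambda>\<eta> x. \<eta> x = 2"
proof
  fix x y assume xy: "x \<in> carrier B" "y \<in> carrier B" "\<And>\<eta>. \<eta> \<in> H \<Longrightarrow> (\<eta> x = 2) \<longleftrightarrow> (\<eta> y = 2)"
  show "x = y"
  proof (rule A_ext)
    show "\<eta> x = \<eta> y" if "\<eta> \<in> H" for \<eta>
      using xy(1,2) xy(3)[OF that] that unfolding B_iff by (metis (full_types))
  qed (use xy in \<open>auto simp: B_iff\<close>)
qed (auto simp: B_ops B_iff p_closed \<eta>_p e12 \<eta>_e12 simp del: One_nat_def)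

text \<open>The coordinate q(a, 0, ..., 1, ..., 0) with 1 in place d is the Boolean value of the
  equation a = e_d. Outside 1, ..., n the zero of B is the default that formal sums require.\<close>

definition vec :: "'a \<Rightarrow> nat \<Rightarrow> 'a" where
  "vec a d = (if d \<in> {1..n} then q (a # (replicate n (e 1))[d - 1 := e 2]) else e 1)"

lemma vec_closed: "a \<in> carrier A \<Longrightarrow> vec a d \<in> carrier A"
  using U_closed[OF _ e12(2), of a d] e12 by (simp add: vec_def U_def)

lemma \<eta>_vec:
  assumes "\<eta> \<in> H" "a \<in> carrier A"
  shows "\<eta> (vec a d) = (if d = \<eta> a then 2 else 1)"
proof (cases "d \<in> {1..n}")
  case True
  have "\<eta> (vec a d) = \<eta> ((replicate n (e 1))[d - 1 := e 2] ! (\<eta> a - 1))"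
    using True \<eta>_q[OF assms(1) _ set_U_args[OF e12(2)] assms(2), of "d - 1"] by (simp add: vec_def)
  also have "(replicate n (e 1))[d - 1 := e 2] ! (\<eta> a - 1) = (if d = \<eta> a then e 2 else e 1)"
    using True \<eta>_mem[OF assms] by (auto simp: nth_list_update)
  finally show ?thesis
    using \<eta>_e12 assms(1) by simp
next
  case False
  then show ?thesis
    using \<eta>_mem[OF assms] \<eta>_e12 assms(1) by (auto simp: vec_def)
qed

lemma vec_point:
  assumes a: "a \<in> carrier A"
  shows "vec a \<in> point_vecs {1..n}" and "\<eta> \<in> H \<Longrightarrow> pt \<eta> (vec a) = \<eta> a"
proof -
  have free: "vec a \<in> free_vecs B {1..n}"
  proof (rule free_vecsI[of _ "{1..n}"])
    show "vec a d \<in> carrier B" for d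
    proof -
      have "\<eta> (vec a d) = 1 \<or> \<eta> (vec a d) = 2" if "\<eta> \<in> H" for \<eta>
        using \<eta>_vec[OF that a, of d] by presburger
      then show ?thesis
        using vec_closed[OF a] by (simp add: B_iff)
    qed
    show "d \<in> {1..n}" if "\<eta> \<in> H" "\<eta> (vec a d) = 2" for \<eta> d
      using that \<eta>_vec[OF that(1) a] \<eta>_mem[OF that(1) a] by (auto split: if_splits)
  qed auto
  have T: "\<eta> (vec a d) = 2 \<longleftrightarrow> d = \<eta> a" if "\<eta> \<in> H" for \<eta> d
    using \<eta>_vec[OF that a, of d] by simp
  show "vec a \<in> point_vecs {1..n}"
    by (rule point_vecsI(1)[OF free T])
  show "pt \<eta> (vec a) = \<eta> a" if "\<eta> \<in> H"
    by (rule point_vecsI(2)[OF free T that])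
qed

lemma vec_surj:
  assumes v: "v \<in> point_vecs {1..n}"
  shows "\<exists>a\<in>carrier A. vec a = v"
proof -
  \<comment> \<open>A nested case distinction: wherever \<open>v d\<close> is true the value becomes
    e_d. Over the full list the starting value \<open>e 1\<close> is overwritten at every \<eta>,
    since the point of v is one of the indices.\<close>
  define glue where "glue ds = foldr (\<lambda>d acc. p_op n A (v d) acc (e d)) ds (e 1)" for ds
  have vB: "v d \<in> carrier B" for d
    using free_vecs_closed[OF point_vecs_free[OF v]] .
  have vA: "v d \<in> carrier A" for d
    using vB by (simp add: B_iff)
  have closed: "glue ds \<in> carrier A" if "set ds \<subseteq> {1..n}" for ds
    using that by (induction ds) (auto simp: glue_def e12[simplified] intro!: p_closed vA e_closed)
  have glue: "\<eta> (glue ds) = (if pt \<eta> v \<in> set ds then pt \<eta> v else 1)"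
    if \<eta>: "\<eta> \<in> H" and ds: "set ds \<subseteq> {1..n}" for \<eta> ds
    using ds
  proof (induction ds)
    case Nil
    then show ?case using \<eta>_e12 \<eta> by (simp add: glue_def)
  next
    case (Cons d ds)
    have "\<eta> (glue (d # ds)) = \<eta> (p_op n A (v d) (glue ds) (e d))"
      by (simp add: glue_def)
    also have "\<dots> = (if \<eta> (v d) = 1 then \<eta> (glue ds) else if \<eta> (v d) = 2 then \<eta> (e d) else \<eta> (v d))"
      using Cons.prems by (intro \<eta>_p \<eta> vA closed e_closed) auto
    also have "\<dots> = (if d = pt \<eta> v then d else \<eta> (glue ds))"
      using vB[of d] \<eta> T_pt[OF v \<eta>, of d] \<eta>_e[OF \<eta>, of d] Cons.prems by (auto simp: B_iff)
    finally show ?case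
      using Cons by auto
  qed
  have sub: "set [1..<Suc n] \<subseteq> {1..n}" by (auto simp del: upt_Suc)
  show ?thesis
  proof
    show "glue [1..<Suc n] \<in> carrier A"
      using closed[OF sub] .
    show "vec (glue [1..<Suc n]) = v"
    proof (rule point_vecs_ext[OF _ v])
      fix \<eta> assume \<eta>: "\<eta> \<in> H"
      have "pt \<eta> v \<in> set [1..<Suc n]"
        using pt_mem[OF v \<eta>] by (auto simp del: upt_Suc)
      then show "pt \<eta> (vec (glue [1..<Suc n])) = pt \<eta> v"
        using vec_point(2)[OF closed[OF sub] \<eta>] glue[OF \<eta> sub] by presburger
    qed (rule vec_point(1)[OF closed[OF sub]])
  qed
qed

section \<open>The isomorphisms between A, the central vectors and the power of n\<close>

abbreviation nB where "nB \<equiv> semiring_power (nu n) (n_alg n) B"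
abbreviation AB where "AB \<equiv> semiring_power (nu n) A B"

lemma n_alg: "ua_algebra (nu n) (n_alg n)"
  using n2 by (intro ua_algebra_n_alg) simp

lemma carrier_nB: "carrier nB = point_vecs {1..n}"
  using carrier_semiring_power[OF n_alg] by (simp add: n_alg_def)

lemma carrier_AB: "carrier AB = point_vecs (carrier A)"
  by (rule carrier_semiring_power[OF A])

lemma carrier_Ce: "carrier (Ce_pow B n) = carrier nB"
  using carrier_Ce_pow n2 by (simp add: carrier_nB)

text \<open>At \<eta> the first argument of q is a single basis vector e_i. The linear combination
  and the lift of the projection operation of n both return the i-th of the remaining arguments
  there.\<close>

lemma interp_Ce:
  assumes f: "f \<in> symbols (nu n)" "xs \<in> args (nu n) nB f"
  shows "interp (Ce_pow B n) f xs = interp nB f xs"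
proof -
  have nB: "interp nB f xs \<in> point_vecs {1..n}"
    using ua_algebra_semiring_power[OF n_alg] f by (auto simp: ua_algebra_def carrier_nB)
  show ?thesis
  proof (cases f)
    case Qop
    then have "length xs = Suc n" "set xs \<subseteq> point_vecs {1..n}"
      using f by (simp_all add: args_def carrier_nB) (simp add: nu_def)
    then obtain v ws where xs: "xs = v # ws" "length ws = n" "v \<in> point_vecs {1..n}"
      "set ws \<subseteq> point_vecs {1..n}"
      by (cases xs) auto
    have len: "length ws = length [1..<Suc n]" using xs by simp
    have free: "v \<in> free_vecs B {1..n}" "set ws \<subseteq> free_vecs B {1..n}"
      using xs point_vecs_free by blast+
    have "q_vec B [1..<Suc n] (v # ws) = interp nB f xs"
    proof (rule vec_ext[OF q_vec_free[OF free(1) len free(2)] point_vecs_free[OF nB]])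
      fix \<eta> d assume \<eta>: "\<eta> \<in> H"
      have p: "pt \<eta> v \<in> {1..n}"
        using pt_mem[OF xs(3) \<eta>] .
      have "range v \<subseteq> carrier B" "\<And>w. w \<in> set ws \<Longrightarrow> range w \<subseteq> carrier B"
        using free by (auto simp: free_vecs_def)
      from T_q_vec[OF \<eta> this(1) len this(2)]
      have "\<eta> (q_vec B [1..<Suc n] (v # ws) d) = 2 \<longleftrightarrow>
          (\<exists>i<n. \<eta> (v (Suc i)) = 2 \<and> \<eta> ((ws ! i) d) = 2)"
        by (simp del: upt_Suc cong: conj_cong)
      \<comment> \<open>The summand at position i carries the coefficient of the basis vector with
        number \<open>Suc i\<close>.\<close>
      also have "\<dots> \<longleftrightarrow> (\<exists>i<n. Suc i = pt \<eta> v \<and> d = pt \<eta> (ws ! i))"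
        using T_pt[OF xs(3) \<eta>] T_pt[OF subsetD[OF xs(4) nth_mem] \<eta>] xs(2) by auto
      also have "\<dots> \<longleftrightarrow> d = pt \<eta> (ws ! (pt \<eta> v - 1))"
      proof -
        have "i < n \<and> Suc i = pt \<eta> v \<longleftrightarrow> i = pt \<eta> v - 1" for i
          using p by auto
        then show ?thesis by metis
      qed
      also have "\<dots> \<longleftrightarrow> d = pt \<eta> (interp nB f xs)"
        using pt_semiring_power[OF n_alg f \<eta>] p xs Qop by (auto simp: n_alg_def nth_Cons')
      finally show "\<eta> (q_vec B [1..<Suc n] (v # ws) d) = 2 \<longleftrightarrow> \<eta> (interp nB f xs d) = 2"
        using T_pt[OF nB \<eta>] by simp
    qed
    then show ?thesis
      using Qop xs by (simp add: Ce_pow_def Ce_def pow_alg_def del: upt_Suc)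
  next
    case (Ec i)
    then have i: "i \<in> {1..n}" "xs = []"
      using f by (auto simp: args_def nu_def)
    have "unit_vec B i = interp nB f xs"
    proof (rule point_vecs_ext[OF unit_vec_point(1)[OF i(1)] nB])
      fix \<eta> assume \<eta>: "\<eta> \<in> H"
      show "pt \<eta> (unit_vec B i) = pt \<eta> (interp nB f xs)"
        using pt_semiring_power[OF n_alg f \<eta>] unit_vec_point(2)[OF i(1) \<eta>] Ec
        by (simp add: n_alg_def)
    qed
    moreover have "map Inr (nu_consts n) ! (i - 1) = (Inr (Ec i) :: 'a sm_sym + nu_sym)"
      using i by (auto simp del: upt_Suc)
    ultimately show ?thesis
      using Ec i by (simp add: Ce_pow_def Ce_def pow_alg_def del: upt_Suc)
  qed
qed

lemma args_Ce: "args (nu n) (Ce_pow B n) f = args (nu n) nB f"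
  by (simp add: args_def carrier_Ce)

lemma ua_algebra_Ce: "ua_algebra (nu n) (Ce_pow B n)"
  using ua_algebra_semiring_power[OF n_alg] interp_Ce
  by (simp add: ua_algebra_def carrier_Ce args_Ce)

text \<open>Elements of \<open>nB\<close> are determined by their points, and its operations act
  pointwise, so it is enough that each composite with \<open>pt \<eta>\<close> respects the
  operations of n.\<close>

lemma hom_nB_I:
  assumes C: "ua_algebra (nu n) C" and h: "h \<in> carrier C \<rightarrow> carrier nB"
    and pt: "\<And>\<eta> f xs. \<eta> \<in> H \<Longrightarrow> f \<in> symbols (nu n) \<Longrightarrow> xs \<in> args (nu n) C f \<Longrightarrow>
      pt \<eta> (h (interp C f xs)) = interp (n_alg n) f (map (\<lambda>x. pt \<eta> (h x)) xs)"
  shows "h \<in> ua_hom (nu n) C nB"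
proof -
  have "h (interp C f xs) = interp nB f (map h xs)"
    if f: "f \<in> symbols (nu n)" "xs \<in> args (nu n) C f" for f xs
  proof (rule point_vecs_ext)
    have hxs: "map h xs \<in> args (nu n) nB f"
      using f h by (auto simp: args_def)
    show "h (interp C f xs) \<in> point_vecs {1..n}"
      using C f h by (auto simp: ua_algebra_def carrier_nB)
    show "interp nB f (map h xs) \<in> point_vecs {1..n}"
      using ua_algebra_semiring_power[OF n_alg] f(1) hxs by (auto simp: ua_algebra_def carrier_nB)
    show "pt \<eta> (h (interp C f xs)) = pt \<eta> (interp nB f (map h xs))" if \<eta>: "\<eta> \<in> H" for \<eta>
      using pt[OF \<eta> f] pt_semiring_power[OF n_alg f(1) hxs \<eta>] by (simp add: comp_def)
  qed
  with h show ?thesis by (auto simp: ua_hom_def)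
qed

text \<open>The composite of \<open>vec\<close> with \<open>pt \<eta>\<close> is the homomorphism
  \<eta>, so \<open>vec\<close> is a homomorphism; it is injective because H separates points, and
  surjective by gluing.\<close>

lemma A_iso_Ce: "ua_isomorphic (nu n) A (Ce_pow B n)"
proof -
  have "vec \<in> ua_hom (nu n) A nB"
  proof (rule hom_nB_I[OF A])
    show "vec \<in> carrier A \<rightarrow> carrier nB"
      using vec_point(1) by (auto simp: carrier_nB)
    fix \<eta> f xs
    assume \<eta>: "\<eta> \<in> H" and f: "f \<in> symbols (nu n)" "xs \<in> args (nu n) A f"
    have xs: "set xs \<subseteq> carrier A" using f by (simp add: args_def)
    have "pt \<eta> (vec (interp A f xs)) = \<eta> (interp A f xs)"
      using A f \<eta> by (intro vec_point(2)) (auto simp: ua_algebra_def)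
    also have "\<dots> = interp (n_alg n) f (map \<eta> xs)"
      using \<eta> f by (simp add: H_def ua_hom_def)
    also have "map \<eta> xs = map (\<lambda>x. pt \<eta> (vec x)) xs"
      using xs vec_point(2)[OF _ \<eta>] by auto
    finally show "pt \<eta> (vec (interp A f xs)) = interp (n_alg n) f (map (\<lambda>x. pt \<eta> (vec x)) xs)" .
  qed
  then have hom: "vec \<in> carrier A \<rightarrow> carrier nB" "\<And>f xs. f \<in> symbols (nu n) \<Longrightarrow> xs \<in> args (nu n) A f \<Longrightarrow>
      vec (interp A f xs) = interp nB f (map vec xs)"
    by (auto simp: ua_hom_def)
  have "interp (Ce_pow B n) f (map vec xs) = interp nB f (map vec xs)"
    if "f \<in> symbols (nu n)" "xs \<in> args (nu n) A f" for f xs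
    using that hom(1) by (intro interp_Ce) (auto simp: args_def)
  with hom have "vec \<in> ua_hom (nu n) A (Ce_pow B n)"
    by (auto simp: ua_hom_def carrier_Ce)
  moreover have "bij_betw vec (carrier A) (carrier (Ce_pow B n))"
  proof (rule bij_betw_imageI)
    show "inj_on vec (carrier A)"
    proof (rule inj_onI, rule A_ext)
      fix a b \<eta> assume "a \<in> carrier A" "b \<in> carrier A" "vec a = vec b" "\<eta> \<in> H"
      then show "\<eta> a = \<eta> b"
        using vec_point(2) by metis
    qed
    show "vec ` carrier A = carrier (Ce_pow B n)"
      using hom(1) vec_surj by (auto simp: carrier_Ce carrier_nB)
  qed
  ultimately show ?thesis
    using A ua_algebra_Ce by (auto simp: ua_isomorphic_def ua_iso_def)
qed

lemma Ce_iso_nB: "ua_isomorphic (nu n) (Ce_pow B n) nB"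
proof -
  have "id \<in> ua_iso (nu n) (Ce_pow B n) nB"
    using interp_Ce by (auto simp: ua_iso_def ua_hom_def carrier_Ce args_Ce)
  then show ?thesis
    using ua_algebra_Ce ua_algebra_semiring_power[OF n_alg] by (auto simp: ua_isomorphic_def)
qed

section \<open>The section and the retraction\<close>

lemma e_hom:
  assumes "f \<in> symbols (nu n)" "length ds = arity (nu n) f" "set ds \<subseteq> {1..n}"
  shows "interp A f (map e ds) = e (interp (n_alg n) f ds)"
proof (cases f)
  case Qop
  then obtain i bs where ds: "ds = i # bs" "i \<in> {1..n}" "length bs = n" "set bs \<subseteq> {1..n}"
    using assms by (cases ds) (auto simp: nu_def)
  have "q (e i # map e bs) = map e bs ! (i - 1)"
    using ds e_closed by (intro q_e) auto
  then show ?thesis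
    using ds Qop by (auto simp: n_alg_def nth_Cons')
next
  case (Ec i)
  then show ?thesis
    using assms by (simp add: nu_def n_alg_def)
qed

lemma nB_retract_AB: "ua_retract (nu n) nB AB"
proof -
  \<comment> \<open>Both maps are linear extensions: F of the embedding of n by the constants, G of
    the coordinate map \<open>vec\<close>. Since \<open>vec a\<close> has the point \<eta> a at
    \<eta>, G applies at each \<eta> that same homomorphism to the point of v.\<close>
  define F where "F v = bind v (\<lambda>i. unit_vec B (e i))" for v :: "nat \<Rightarrow> 'a"
  define G where "G v = bind v vec" for v :: "'a \<Rightarrow> 'a"
  have F: "F v \<in> point_vecs (carrier A)" "\<eta> \<in> H \<Longrightarrow> pt \<eta> (F v) = e (pt \<eta> v)"
    if v: "v \<in> point_vecs {1..n}" for v \<eta>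
  proof -
    have u: "unit_vec B (e i) \<in> point_vecs (carrier A)" if "i \<in> {1..n}" for i
      using unit_vec_point(1)[OF e_closed[OF that]] .
    show "F v \<in> point_vecs (carrier A)"
      unfolding F_def using v u by (rule bind_point(1))
    assume \<eta>: "\<eta> \<in> H"
    have "pt \<eta> (F v) = pt \<eta> (unit_vec B (e (pt \<eta> v)))"
      unfolding F_def using v u \<eta> by (rule bind_point(2))
    then show "pt \<eta> (F v) = e (pt \<eta> v)"
      using unit_vec_point(2)[OF e_closed[OF pt_mem[OF v \<eta>]] \<eta>] by simp
  qed
  have G: "G v \<in> point_vecs {1..n}" "\<eta> \<in> H \<Longrightarrow> pt \<eta> (G v) = \<eta> (pt \<eta> v)"
    if v: "v \<in> point_vecs (carrier A)" for v \<eta>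
  proof -
    show "G v \<in> point_vecs {1..n}"
      unfolding G_def using v vec_point(1) by (rule bind_point(1))
    assume \<eta>: "\<eta> \<in> H"
    have "pt \<eta> (G v) = pt \<eta> (vec (pt \<eta> v))"
      unfolding G_def using v vec_point(1) \<eta> by (rule bind_point(2))
    then show "pt \<eta> (G v) = \<eta> (pt \<eta> v)"
      using vec_point(2)[OF pt_mem[OF v \<eta>] \<eta>] by simp
  qed
  have AB: "ua_algebra (nu n) AB" and nB: "ua_algebra (nu n) nB"
    using ua_algebra_semiring_power A n_alg by auto
  have "F \<in> ua_hom (nu n) nB AB"
  proof -
    have "F (interp nB f xs) = interp AB f (map F xs)"
      if f: "f \<in> symbols (nu n)" "xs \<in> args (nu n) nB f" for f xs
    proof (rule point_vecs_ext)
      have xs: "set xs \<subseteq> point_vecs {1..n}" "length xs = arity (nu n) f"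
        using f by (auto simp: args_def carrier_nB)
      have Fxs: "map F xs \<in> args (nu n) AB f"
        using xs F(1) by (auto simp: args_def carrier_AB)
      have ix: "interp nB f xs \<in> point_vecs {1..n}"
        using nB f by (auto simp: ua_algebra_def carrier_nB)
      show "F (interp nB f xs) \<in> point_vecs (carrier A)"
        using F(1)[OF ix] .
      show "interp AB f (map F xs) \<in> point_vecs (carrier A)"
        using AB f(1) Fxs by (auto simp: ua_algebra_def carrier_AB)
      fix \<eta> assume \<eta>: "\<eta> \<in> H"
      \<comment> \<open>Pointwise F applies \<open>e\<close>, which by \<open>e_hom\<close> commutes
        with the operations.\<close>
      have "pt \<eta> (F (interp nB f xs)) = e (interp (n_alg n) f (map (pt \<eta>) xs))"
        using F(2)[OF ix \<eta>] pt_semiring_power[OF n_alg f \<eta>] by simp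
      also have "\<dots> = interp A f (map e (map (pt \<eta>) xs))"
        using f(1) xs pt_mem[OF _ \<eta>] by (intro e_hom[symmetric]) auto
      also have "map e (map (pt \<eta>) xs) = map (pt \<eta>) (map F xs)"
        using xs F(2)[OF _ \<eta>] by auto
      also have "interp A f (map (pt \<eta>) (map F xs)) = pt \<eta> (interp AB f (map F xs))"
        using pt_semiring_power[OF A f(1) Fxs \<eta>] by simp
      finally show "pt \<eta> (F (interp nB f xs)) = pt \<eta> (interp AB f (map F xs))" .
    qed
    then show ?thesis
      using F(1) by (auto simp: ua_hom_def carrier_nB carrier_AB)
  qed
  moreover have "G \<in> ua_hom (nu n) AB nB"
  proof (rule hom_nB_I[OF AB])
    show "G \<in> carrier AB \<rightarrow> carrier nB"
      using G(1) by (auto simp: carrier_nB carrier_AB)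
    fix \<eta> f xs
    assume \<eta>: "\<eta> \<in> H" and f: "f \<in> symbols (nu n)" "xs \<in> args (nu n) AB f"
    have xs: "set xs \<subseteq> point_vecs (carrier A)" "length xs = arity (nu n) f"
      using f by (auto simp: args_def carrier_AB)
    have ix: "interp AB f xs \<in> point_vecs (carrier A)"
      using AB f by (auto simp: ua_algebra_def carrier_AB)
    have pxs: "map (pt \<eta>) xs \<in> args (nu n) A f"
      using xs pt_mem[OF _ \<eta>] by (auto simp: args_def)
    have "pt \<eta> (G (interp AB f xs)) = \<eta> (interp A f (map (pt \<eta>) xs))"
      using G(2)[OF ix \<eta>] pt_semiring_power[OF A f \<eta>] by simp
    also have "\<dots> = interp (n_alg n) f (map \<eta> (map (pt \<eta>) xs))"
      using \<eta> f(1) pxs unfolding H_def ua_hom_def by blast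
    also have "map \<eta> (map (pt \<eta>) xs) = map (\<lambda>x. pt \<eta> (G x)) xs"
      using xs G(2)[OF _ \<eta>] by auto
    finally show "pt \<eta> (G (interp AB f xs)) = interp (n_alg n) f (map (\<lambda>x. pt \<eta> (G x)) xs)" .
  qed
  \<comment> \<open>Pointwise this is \<eta> (e_i) = i.\<close>
  moreover have "G (F v) = v" if v: "v \<in> carrier nB" for v
  proof (rule point_vecs_ext)
    have v': "v \<in> point_vecs {1..n}" using v by (simp add: carrier_nB)
    then show "v \<in> point_vecs {1..n}" "G (F v) \<in> point_vecs {1..n}"
      using F(1) G(1) by auto
    show "pt \<eta> (G (F v)) = pt \<eta> v" if \<eta>: "\<eta> \<in> H" for \<eta>
      using G(2)[OF F(1)[OF v'] \<eta>] F(2)[OF v' \<eta>] \<eta>_e[OF \<eta> pt_mem[OF v' \<eta>]] by simp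
  qed
  ultimately show ?thesis
    using AB nB by (auto simp: ua_retract_def)
qed

end

theorem theorem6p10:
  fixes n :: nat and A :: "(nu_sym, 'a) ualg"
  assumes "n \<ge> 2"
    and "pure_boolean_like n A"
  shows "ua_isomorphic (nu n) A (Ce_pow (B_semiring n A) n) \<and>
    ua_isomorphic (nu n) (Ce_pow (B_semiring n A) n)
      (semiring_power (nu n) (n_alg n) (B_semiring n A)) \<and>
    ua_retract (nu n) (semiring_power (nu n) (n_alg n) (B_semiring n A))
      (semiring_power (nu n) A (B_semiring n A))"
proof -
  interpret pure_bla n A
    using assms by unfold_locales
  show ?thesis
    using A_iso_Ce Ce_iso_nB nB_retract_AB by blast
qed

end
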